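(* Let $A:\Lambda\to\mathcal{M}^*$, $t\mapsto\underline A_t$, be a smooth family satisfying (A1)-(A2). Then for every $\epsilon>0$ and $\tilde\eta$-a.e. $(t,\hat v)\in\Lambda\times\mathbb{P}^1$ there exist $c_0(\epsilon)>0$ and $n_0(\epsilon,t,\hat v)\in\mathbb{N}$ such that for all $n\ge n_0(\epsilon,t,\hat v)$ and a unit vector $v$ representing $\hat v$, $$\mu\Big\{\omega\in X:\ \Big|\tfrac1n\log\|A_t^n(\omega)v\|-L_1(A_t)\Big|>\epsilon\Big\}<e^{-c_0(\epsilon)n^{1/3}}.$$ Moreover, for Lebesgue a.e. $t\in\Lambda$, for every $\epsilon>0$ there are $c_0(\epsilon)>0$ and $n_0(\epsilon,t)$ such that for all $n\ge n_0(\epsilon,t)$ $$\mu\Big\{\omega\in X:\ \Big|\tfrac1n\log\|A_t^n(\omega)\|-L_1(A_t)\Big|>\epsilon\Big\}<e^{-c_0(\epsilon)n^{1/3}}.$$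
   Context: Bernoulli setting: $\mathscr{A}=\{1,\dots,k\}=\mathscr{A}_{\mathrm{sing}}\sqcup\mathscr{A}_{\mathrm{inv}}$ both nonempty, $p_i>0$, $X=\mathscr{A}^{\mathbb{Z}}$, $\mu=p^{\mathbb{Z}}$. $\mathcal{M}^*$: tuples $(A_1,\dots,A_k)$ with $\mathrm{rank}A_i=1$ ($i\in\mathscr{A}_{\mathrm{sing}}$), $\det A_j>0$ ($j\in\mathscr{A}_{\mathrm{inv}}$), $\hat r_i\ne\hat k_j$ for $i,j\in\mathscr{A}_{\mathrm{sing}}$ ($r_i,k_i$ range and kernel of $A_i$). $\Lambda\subset\mathbb{R}$ compact interval of length 1; (A1) $A_t(i)\equiv A_i$ for $i\in\mathscr{A}_{\mathrm{sing}}$; (A2) there is $c_0>0$ with $\frac{A_t(j)v\wedge\frac{d}{dt}A_t(j)v}{\|A_t(j)v\|^2}\ge c_0$ for all $t\in\Lambda$, $j\in\mathscr{A}_{\mathrm{inv}}$, $\hat v$. $A_t^n(\omega)=A_t(\omega_n)\cdots A_t(\omega_1)$, $L_1(A_t)=\lim_n\frac1n\log\|A_t^n(\omega)\|$ $\mu$-a.e. Projective action of rank one matrices: constant map to the range. $\eta_t$ is the unique stationary probability of $\mathcal{Q}_t\psi(\hat v)=\sum_ip_i\psi(\hat A_t(i)\hat v)$, explicitly $\eta_t=\sum_{s\in\mathscr{A}_{\mathrm{sing}}}p_s\sum_{n\ge0}\sum_{\underline\omega\in\mathscr{A}_{\mathrm{inv}}^n}p(\underline\omega)\delta_{\hat A_t^n(\underline\omega)\hat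 r_s}$. $\tilde\eta$ is the probability on $\Lambda\times\mathbb{P}^1$ with $\int\phi\,d\tilde\eta=\int_\Lambda\int\phi(t,\hat v)\,d\eta_t(\hat v)\,dt$ (Lebesgue measure on $\Lambda$). *)

theory Defs
  imports "HOL-Probability.Probability"
begin

type_synonym mat2 = "real^2^2"

definition smooth_on :: "real set \<Rightarrow> (real \<Rightarrow> real) \<Rightarrow> bool" where
  "smooth_on S f \<longleftrightarrow> (\<exists>U. open U \<and> S \<subseteq> U \<and>
     (\<forall>m. \<forall>x\<in>U. ((deriv ^^ m) f) field_differentiable (at x)))"

definition smooth_mat_family :: "real set \<Rightarrow> (real \<Rightarrow> mat2) \<Rightarrow> bool" where
  "smooth_mat_family S M \<longleftrightarrow> (\<forall>a b. smooth_on S (\<lambda>t. M t $ a $ b))"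

definition wedge :: "real^2 \<Rightarrow> real^2 \<Rightarrow> real" where
  "wedge x y = x $ 1 * y $ 2 - x $ 2 * y $ 1"

definition mnorm :: "mat2 \<Rightarrow> real" where
  "mnorm M = onorm (\<lambda>x. M *v x)"

definition range_space :: "mat2 \<Rightarrow> (real^2) set" where
  "range_space M = range (\<lambda>x. M *v x)"

definition kernel_space :: "mat2 \<Rightarrow> (real^2) set" where
  "kernel_space M = {x. M *v x = 0}"

definition in_Mstar :: "nat set \<Rightarrow> nat set \<Rightarrow> (nat \<Rightarrow> mat2) \<Rightarrow> bool" where
  "in_Mstar Sing Inv M \<longleftrightarrow>
     (\<forall>i\<in>Sing. rank (M i) = 1) \<and> (\<forall>j\<in>Inv. det (M j) > 0) \<and>
     (\<forall>i\<in>Sing. \<forall>j\<in>Sing. range_space (M i) \<noteq> kernel_space (M j))"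

fun mprod :: "(nat \<Rightarrow> mat2) \<Rightarrow> nat list \<Rightarrow> mat2" where
  "mprod M [] = mat 1"
| "mprod M (x # xs) = mprod M xs ** M x"

definition cocycle :: "(nat \<Rightarrow> mat2) \<Rightarrow> nat \<Rightarrow> (int \<Rightarrow> nat) \<Rightarrow> mat2" where
  "cocycle M n \<omega> = mprod M (map (\<lambda>i. \<omega> (int i)) [1..<n+1])"

definition bernoulli :: "nat pmf \<Rightarrow> (int \<Rightarrow> nat) measure" where
  "bernoulli P = PiM (UNIV :: int set) (\<lambda>_. measure_pmf P)"

definition elog :: "real \<Rightarrow> ereal" where
  "elog x = (if x > 0 then ereal (ln x) else -\<infinity>)"

definition L1 :: "nat pmf \<Rightarrow> (nat \<Rightarrow> mat2) \<Rightarrow> ereal" where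
  "L1 P M = (THE L. AE \<omega> in bernoulli P.
      (\<lambda>n. ereal (1 / real n) * elog (mnorm (cocycle M n \<omega>))) \<longlonglongrightarrow> L)"

text \<open>The event |(1/n) log x - L| > eps, with log 0 = -infinity (so for finite L,
  x = 0 always deviates; for L = -infinity, deviation means x > 0).\<close>
definition deviates :: "nat \<Rightarrow> real \<Rightarrow> ereal \<Rightarrow> real \<Rightarrow> bool" where
  "deviates n x L \<epsilon> = (case L of ereal l \<Rightarrow> x \<le> 0 \<or> \<bar>ln x / real n - l\<bar> > \<epsilon>
                                | _ \<Rightarrow> x > 0)"

text \<open>Projective line P^1 is parametrised by angles in [0, pi); pang v is the
  angle of the line through the nonzero vector v.\<close>
definition pang :: "real^2 \<Rightarrow> real" where
  "pang v = (let \<theta> = Arg (Complex (v $ 1) (v $ 2)) in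
              if \<theta> < 0 then \<theta> + pi else if \<theta> = pi then 0 else \<theta>)"

definition rvec :: "mat2 \<Rightarrow> real^2" where
  "rvec M = (SOME v. v \<noteq> 0 \<and> v \<in> range_space M)"

definition words :: "nat set \<Rightarrow> nat \<Rightarrow> nat list set" where
  "words Inv n = {ws. set ws \<subseteq> Inv \<and> length ws = n}"

definition wprob :: "nat pmf \<Rightarrow> nat list \<Rightarrow> real" where
  "wprob P ws = (\<Prod>x\<leftarrow>ws. pmf P x)"

text \<open>The stationary measure eta_t (on angles), given the matrices M = A_t:
  eta = sum_s p_s sum_n sum_{w in Inv^n} p(w) delta_{A^n(w) r_s}.\<close>
definition eta :: "nat pmf \<Rightarrow> nat set \<Rightarrow> nat set \<Rightarrow> (nat \<Rightarrow> mat2) \<Rightarrow> real measure" where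
  "eta P Sing Inv M = measure_of UNIV (sets borel)
     (\<lambda>B. \<Sum>s\<in>Sing. ennreal (pmf P s) *
        (\<Sum>n. \<Sum>ws\<in>words Inv n. ennreal (wprob P ws) *
             indicator B (pang (mprod M ws *v rvec (M s)))))"

definition eta_tilde :: "nat pmf \<Rightarrow> nat set \<Rightarrow> nat set \<Rightarrow> real set \<Rightarrow>
     (real \<Rightarrow> nat \<Rightarrow> mat2) \<Rightarrow> (real \<times> real) measure" where
  "eta_tilde P Sing Inv \<Lambda> A = measure_of UNIV (sets (borel :: (real \<times> real) measure))
     (\<lambda>B. \<integral>\<^sup>+ t. indicator \<Lambda> t * emeasure (eta P Sing Inv (A t)) (Pair t -` B) \<partial>lborel)"

end

(* Singular letters send every direction to a fixed line, so the process renews at each of them: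
   log |A^n v| is a sum of gains ln |wedge (A_w r_s) kappa_s'| over the blocks w of invertible letters
   between two singular letters s, s'.

   Winding makes wedge (A_t(w) r) kappa a function of t whose sublevel sets at height delta have
   measure at most exp(C |w|) * delta.  Taking delta = exp(-K |w|) with K large beats the number of
   words of each length, so by Borel-Cantelli, for almost every t, every gain is at most K' (|w| + 1)
   in absolute value.  Block lengths are geometric, hence gains have exponential moments.

   For such t a second-order expansion yields, for small z of either sign, a function Phi with
   E Phi(A v) <= exp(z L + delta |z|) Phi(v), which bounds E |A^n v|^z and gives exponential Chernoff
   estimates.  Their rate depends on t, but exp(-c(t) n) is eventually below exp(-n^(1/3)), so the
   constant in the theorem can be taken to be 1. *)

theory Submission
  imports Defs "HOL-Real_Asymp.Real_Asymp"
begin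

section \<open>Words and cylinders\<close>

text \<open>Deviations below the mean call for negative moments, hence for lower bounds on norms.
  The danger is a block whose image \<open>A_w r_s\<close> comes close to the kernel line of the
  next singular letter; for an individual t it may even lie on that line, so one argues for almost
  every t. Winding survives composition because invertible letters have positive determinant:
  earlier letters can only add rotation in the same sense. The empty word does not move with t, and
  there the condition that ranges differ from kernels takes over.

  For fixed t, \<open>eta\<close> charges only the countably many directions \<open>A_w r_s\<close>.
  It is enough to bound moments at the vectors \<open>r_s\<close>: as w has positive probability,
  such a bound passes to \<open>A_w r_s\<close>, with a constant depending on w. Words without
  singular letter never renew; a strict gap in the inequality for \<open>Phi\<close> at the vectors
  \<open>r_s\<close> pays for them. The matrix norm follows from two non-parallel directions of this
  kind, and it is through the matrix norm that \<open>L1\<close> is identified.\<close>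

lemma finite_words: "finite S \<Longrightarrow> finite (words S n)"
  unfolding words_def by (rule finite_lists_length_eq)

lemma words_0 [simp]: "words S 0 = {[]}"
  by (auto simp: words_def)

lemma words_Suc: "words S (Suc n) = (\<lambda>(i, w). i # w) ` (S \<times> words S n)"
  by (auto simp: words_def length_Suc_conv)

lemma sum_words_Suc:
  "(\<Sum>w\<in>words S (Suc n). F w) = (\<Sum>i\<in>S. \<Sum>w\<in>words S n. F (i # w))"
  unfolding words_Suc
  by (subst sum.reindex) (auto simp: inj_on_def sum.cartesian_product split_beta)

lemma wprob_Nil [simp]: "wprob P [] = 1"
  and wprob_Cons [simp]: "wprob P (i # w) = pmf P i * wprob P w"
  by (auto simp: wprob_def)

lemma wprob_nonneg [simp]: "wprob P w \<ge> 0"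
  unfolding wprob_def by (induction w) auto

lemma sum_wprob_words: "(\<Sum>w\<in>words S n. wprob P w) = (\<Sum>i\<in>S. pmf P i) ^ n"
  by (induction n) (auto simp: sum_words_Suc sum_distrib_left[symmetric] sum_distrib_right)

lemma mprod_append: "mprod M (u @ w) = mprod M w ** mprod M u"
  by (induction u) (auto simp: matrix_mul_assoc)

lemma mprod_Cons_vec: "mprod M (i # w) *v v = mprod M w *v (M i *v v)"
  by (simp add: matrix_vector_mul_assoc)

lemma mprod_append_vec: "mprod M (u @ w) *v v = mprod M w *v (mprod M u *v v)"
  by (simp add: mprod_append matrix_vector_mul_assoc)

definition pre :: "nat \<Rightarrow> (int \<Rightarrow> nat) \<Rightarrow> nat list" where
  "pre n \<omega> = map (\<lambda>i. \<omega> (int i)) [1..<n+1]"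

lemma cocycle_pre: "cocycle M n \<omega> = mprod M (pre n \<omega>)"
  by (simp add: cocycle_def pre_def)

lemma length_pre [simp]: "length (pre n \<omega>) = n"
  by (simp add: pre_def)

interpretation bern: product_prob_space "\<lambda>_::int. measure_pmf P" UNIV for P :: "nat pmf"
  ..

lemma prob_space_bernoulli: "prob_space (bernoulli P)"
  unfolding bernoulli_def by (rule bern.prob_space_axioms)

lemma space_bernoulli [simp]: "space (bernoulli P) = UNIV"
  by (simp add: bernoulli_def space_PiM)

text \<open>Puts a prefix event in the form to which the product measure formula applies; list
  position \<open>i\<close> is the integer coordinate \<open>i + 1\<close>.\<close>

lemma pre_eq_cylinder:
  assumes "length w = n"
  shows "{\<omega>. pre n \<omega> = w} =
    prod_emb UNIV (\<lambda>_. measure_pmf P) {1..int n} (Pi\<^sub>E {1..int n} (\<lambda>j. {w ! nat (j - 1)}))"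
    (is "_ = ?R")
proof (rule set_eqI)
  fix \<omega> :: "int \<Rightarrow> nat"
  have "pre n \<omega> = w \<longleftrightarrow> (\<forall>i<n. \<omega> (int (Suc i)) = w ! i)"
    using assms by (simp add: list_eq_iff_nth_eq pre_def del: upt_Suc)
  also have "\<dots> \<longleftrightarrow> (\<forall>j\<in>{1..int n}. \<omega> j = w ! nat (j - 1))"
  proof safe
    fix j assume *: "\<forall>i<n. \<omega> (int (Suc i)) = w ! i" "j \<in> {1..int n}"
    then show "\<omega> j = w ! nat (j - 1)"
      using *(1)[rule_format, of "nat (j - 1)"] by auto
  next
    fix i assume "\<forall>j\<in>{1..int n}. \<omega> j = w ! nat (j - 1)" "i < n"
    then show "\<omega> (int (Suc i)) = w ! i" by (auto dest: bspec[where x = "int (Suc i)"])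
  qed
  finally show "\<omega> \<in> {\<omega>. pre n \<omega> = w} \<longleftrightarrow> \<omega> \<in> ?R"
    by (auto simp: prod_emb_def PiE_iff space_PiM)
qed

lemma measure_pre_eq:
  assumes "length w = n"
  shows "{\<omega>. pre n \<omega> = w} \<in> sets (bernoulli P)"
    and "measure (bernoulli P) {\<omega>. pre n \<omega> = w} = wprob P w"
proof -
  show "{\<omega>. pre n \<omega> = w} \<in> sets (bernoulli P)"
    unfolding pre_eq_cylinder[OF assms, of P] bernoulli_def
    by (rule sets_PiM_I) auto
  have "measure (bernoulli P) {\<omega>. pre n \<omega> = w}
      = (\<Prod>j\<in>{1..int n}. pmf P (w ! nat (j - 1)))"
    unfolding pre_eq_cylinder[OF assms, of P] bernoulli_def
    by (subst bern.measure_PiM_emb) (auto simp: measure_pmf_single)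
  also have "\<dots> = (\<Prod>i<n. pmf P (w ! i))"
    by (rule prod.reindex_bij_witness[where i = "\<lambda>i. int i + 1" and j = "\<lambda>j. nat (j - 1)"]) auto
  also have "\<dots> = wprob P w"
    using assms by (simp add: wprob_def prod.list_conv_set_nth atLeast0LessThan)
  finally show "measure (bernoulli P) {\<omega>. pre n \<omega> = w} = wprob P w" .
qed

lemma sets_pre: "{\<omega>. Q (pre n \<omega>)} \<in> sets (bernoulli P)"
proof -
  have "{\<omega>. Q (pre n \<omega>)} = (\<Union>w\<in>{w. length w = n \<and> Q w}. {\<omega>. pre n \<omega> = w})" by auto
  also have "\<dots> \<in> sets (bernoulli P)"
    by (rule sets.countable_UN') (auto intro: measure_pre_eq(1) countableI_type)
  finally show ?thesis .
qed

text \<open>A word with a letter off the support has a vanishing factor in \<open>wprob\<close>, and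
  there are only countably many words.\<close>

lemma AE_pre_words: "AE \<omega> in bernoulli P. pre n \<omega> \<in> words (set_pmf P) n"
proof -
  interpret prob_space "bernoulli P" by (rule prob_space_bernoulli)
  have "AE \<omega> in bernoulli P. pre n \<omega> \<noteq> w" if "w \<notin> words (set_pmf P) n" for w
  proof (cases "length w = n")
    case True
    then have "\<not> set w \<subseteq> set_pmf P" using that by (simp add: words_def)
    then obtain x where "x \<in> set w" "x \<notin> set_pmf P" by blast
    then have "wprob P w = 0" unfolding wprob_def prod_list_zero_iff by (auto simp: pmf_eq_0_set_pmf intro!: image_eqI)
    then have "emeasure (bernoulli P) {\<omega>. pre n \<omega> = w} = 0"
      using measure_pre_eq(2)[where P = P, OF True] by (simp add: emeasure_eq_measure)
    then show ?thesis using measure_pre_eq(1)[where P = P, OF True]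
      by (intro AE_I[where N = "{\<omega>. pre n \<omega> = w}"]) auto
  qed auto
  then have "AE \<omega> in bernoulli P. \<forall>w. w \<notin> words (set_pmf P) n \<longrightarrow> pre n \<omega> \<noteq> w"
    by (subst AE_all_countable) auto
  then show ?thesis by eventually_elim auto
qed

text \<open>Every event about the first \<open>n\<close> letters becomes a finite weighted sum, so
  that all later expectations are sums over words.\<close>

lemma measure_pre:
  assumes "finite (set_pmf P)"
  shows "measure (bernoulli P) {\<omega>. Q (pre n \<omega>)}
    = (\<Sum>w\<in>words (set_pmf P) n. wprob P w * of_bool (Q w))"
proof -
  interpret prob_space "bernoulli P" by (rule prob_space_bernoulli)
  let ?W = "{w \<in> words (set_pmf P) n. Q w}"
  have fin: "finite (words (set_pmf P) n)" using assms by (rule finite_words)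
  have len: "length w = n" if "w \<in> ?W" for w using that by (auto simp: words_def)
  have "measure (bernoulli P) {\<omega>. Q (pre n \<omega>)}
      = measure (bernoulli P) (\<Union>w\<in>?W. {\<omega>. pre n \<omega> = w})"
    using AE_pre_words[of n P]
    by (intro finite_measure_eq_AE sets_pre sets.finite_UN) (auto simp: fin len intro: measure_pre_eq(1))
  also have "\<dots> = (\<Sum>w\<in>?W. measure (bernoulli P) {\<omega>. pre n \<omega> = w})"
    by (rule finite_measure_finite_Union) (auto simp: fin disjoint_family_on_def len intro!: measure_pre_eq(1))
  also have "\<dots> = (\<Sum>w\<in>?W. wprob P w)"
    by (rule sum.cong) (auto simp: len measure_pre_eq(2))
  also have "\<dots> = (\<Sum>w\<in>words (set_pmf P) n. wprob P w * of_bool (Q w))"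
    using fin by (simp add: sum.inter_filter of_bool_def if_distrib cong: if_cong)
  finally show ?thesis .
qed

section \<open>Large deviations along renewals\<close>

lemma wedge_scaleR_left [simp]: "wedge (c *\<^sub>R x) y = c * wedge x y"
  by (simp add: wedge_def algebra_simps)

text \<open>Second-order Lagrange remainder, bounded through \<open>exp \<bar>x\<bar>\<close> so
  that both signs of \<open>x\<close> are covered.\<close>

lemma exp_le_quadratic: "exp x \<le> 1 + x + x\<^sup>2 * exp \<bar>x\<bar>" for x :: real
proof -
  obtain t where t: "\<bar>t\<bar> \<le> \<bar>x\<bar>" "exp x = (\<Sum>m<2. x ^ m / fact m) + exp t / fact 2 * x ^ 2"
    using Maclaurin_exp_le[of x 2] by blast
  have "exp t \<le> exp \<bar>x\<bar>" using t(1) by simp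
  moreover have "exp t > 0" by simp
  ultimately have "exp t / 2 \<le> exp \<bar>x\<bar>" by linarith
  then have "exp t / 2 * x\<^sup>2 \<le> exp \<bar>x\<bar> * x\<^sup>2"
    by (rule mult_right_mono) simp
  then show ?thesis using t(2) by (simp add: numeral_2_eq_2 mult.commute)
qed

text \<open>Lagrange's identity in the plane: squared sine plus squared cosine.\<close>

lemma wedge_square_add_inner_square: "(wedge x y)\<^sup>2 + (x \<bullet> y)\<^sup>2 = (norm x * norm y)\<^sup>2"
  unfolding power_mult_distrib power2_norm_eq_inner
  by (simp add: wedge_def inner_vec_def sum_2 power2_eq_square algebra_simps)

lemma abs_wedge_le: "\<bar>wedge x y\<bar> \<le> norm x * norm y"
proof -
  have "(wedge x y)\<^sup>2 \<le> (norm x * norm y)\<^sup>2"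
    using wedge_square_add_inner_square[of x y] zero_le_power2[of "x \<bullet> y"] by linarith
  then show ?thesis by (simp add: abs_le_square_iff[symmetric] abs_mult)
qed

lemma norm_mult_mnorm: "norm (B *v x) \<le> mnorm B * norm x"
  unfolding mnorm_def by (rule onorm) (simp add: linear_conv_bounded_linear[symmetric])

text \<open>Non-parallel vectors form a basis, so a matrix is controlled by its values on them;
  \<open>D\<close> depends on the pair alone.\<close>

lemma mnorm_le_pair:
  assumes "wedge v1 v2 \<noteq> 0"
  obtains D where "D > 0" "\<And>B. mnorm B \<le> D * max (norm (B *v v1)) (norm (B *v v2))"
proof
  define d where "d = \<bar>wedge v1 v2\<bar>"
  have d: "d > 0" using assms by (simp add: d_def)
  have v1: "norm v1 + norm v2 > 0" using assms by (auto simp: wedge_def add_nonneg_eq_0_iff less_le)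
  show "(norm v1 + norm v2) / d > 0" using d v1 by simp
  fix B :: mat2
  define m where "m = max (norm (B *v v1)) (norm (B *v v2))"
  show "mnorm B \<le> (norm v1 + norm v2) / d * m"
    unfolding mnorm_def
  proof (rule onorm_le)
    fix x :: "real^2"
    \<comment> \<open>Cramer's rule for the coordinates of \<open>x\<close> in the basis
      \<open>v1\<close>, \<open>v2\<close>.\<close>
    have "wedge v1 v2 *\<^sub>R x = wedge x v2 *\<^sub>R v1 + wedge v1 x *\<^sub>R v2"
      by (simp add: vec_eq_iff forall_2 wedge_def algebra_simps)
    then have "wedge v1 v2 *\<^sub>R (B *v x) = wedge x v2 *\<^sub>R (B *v v1) + wedge v1 x *\<^sub>R (B *v v2)"
      by (metis matrix_vector_mult_scaleR matrix_vector_right_distrib)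
    then have "d * norm (B *v x) = norm (wedge x v2 *\<^sub>R (B *v v1) + wedge v1 x *\<^sub>R (B *v v2))"
      unfolding d_def by (metis norm_scaleR)
    also have "\<dots> \<le> \<bar>wedge x v2\<bar> * norm (B *v v1) + \<bar>wedge v1 x\<bar> * norm (B *v v2)"
      by (rule order_trans[OF norm_triangle_ineq]) simp
    also have "\<dots> \<le> (norm x * norm v2) * m + (norm v1 * norm x) * m"
      by (intro add_mono mult_mono abs_wedge_le) (auto simp: m_def)
    finally show "norm (B *v x) \<le> (norm v1 + norm v2) / d * m * norm x"
      using d by (simp add: field_simps)
  qed
qed

lemma abs_divide_le_iff:
  assumes "n \<ge> 1"
  shows "\<bar>x / real n - l\<bar> \<le> e \<longleftrightarrow> real n * (l - e) \<le> x \<and> x \<le> real n * (l + e)"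
proof -
  have "\<bar>x / real n - l\<bar> \<le> e \<longleftrightarrow> l - e \<le> x / real n \<and> x / real n \<le> l + e" by linarith
  then show ?thesis using assms by (simp add: pos_le_divide_eq pos_divide_le_eq mult.commute)
qed

text \<open>What is retained of one good parameter value; \<open>\<kappa> s\<close> spans the kernel
  of \<open>M s\<close>. Non-vanishing is assumed separately because \<open>ln 0 = 0\<close> would
  let \<open>ln_wedge\<close> hold for a vanishing wedge. The bounds involve
  \<open>real n + 1\<close> so that the empty word is covered.\<close>

locale renewal_cocycle =
  fixes P :: "nat pmf" and Sing Inv :: "nat set" and M :: "nat \<Rightarrow> mat2"
    and r \<kappa> :: "nat \<Rightarrow> real^2" and K :: real
  assumes finite_Sing: "finite Sing" and finite_Inv: "finite Inv"
    and disj: "Sing \<inter> Inv = {}" and Sing_ne: "Sing \<noteq> {}" and Inv_ne: "Inv \<noteq> {}"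
    and supp: "set_pmf P = Sing \<union> Inv"
    and M_Sing: "s \<in> Sing \<Longrightarrow> M s *v x = wedge x (\<kappa> s) *\<^sub>R r s"
    and wedge_nz: "s \<in> Sing \<Longrightarrow> s' \<in> Sing \<Longrightarrow> w \<in> words Inv n \<Longrightarrow> wedge (mprod M w *v r s) (\<kappa> s') \<noteq> 0"
    and ln_wedge: "s \<in> Sing \<Longrightarrow> s' \<in> Sing \<Longrightarrow> w \<in> words Inv n \<Longrightarrow>
      \<bar>ln \<bar>wedge (mprod M w *v r s) (\<kappa> s')\<bar>\<bar> \<le> K * (real n + 1)"
    and ln_norm: "s \<in> Sing \<Longrightarrow> w \<in> words Inv n \<Longrightarrow>
      \<bar>ln (norm (mprod M w *v r s))\<bar> \<le> K * (real n + 1)"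
begin

section \<open>Discounted moments and conditioning on the first letter\<close>

definition markov_iter :: "nat \<Rightarrow> (real^2 \<Rightarrow> real) \<Rightarrow> real^2 \<Rightarrow> real" where
  "markov_iter n f v = (\<Sum>w\<in>words (Sing \<union> Inv) n. wprob P w * f (mprod M w *v v))"

definition phi :: "real \<Rightarrow> real \<Rightarrow> (nat \<Rightarrow> real) \<Rightarrow> nat \<Rightarrow> real^2 \<Rightarrow> real" where
  "phi z \<beta> b m v = exp (- \<beta> * (real m + 1)) * (\<Sum>w\<in>words Inv m. \<Sum>s\<in>Sing.
     wprob P w * pmf P s * b s * \<bar>wedge (mprod M w *v v) (\<kappa> s)\<bar> powr z)"

text \<open>Up to the discount \<open>\<beta>\<close> per letter, \<open>phi\<close> is the \<open>z\<close>-th moment of the factor collected at the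
  first singular letter when that letter comes at time \<open>m + 1\<close> and is then rewarded by \<open>b\<close>;
  \<open>Phi\<close> truncates at time \<open>n\<close>.\<close>

definition Phi :: "real \<Rightarrow> real \<Rightarrow> (nat \<Rightarrow> real) \<Rightarrow> nat \<Rightarrow> real^2 \<Rightarrow> real" where
  "Phi z \<beta> b n v = (\<Sum>m<n. phi z \<beta> b m v)"

text \<open>The share of \<open>moment\<close> carried by words that meet no singular
  letter.\<close>

definition inv_part :: "real \<Rightarrow> real \<Rightarrow> nat \<Rightarrow> real^2 \<Rightarrow> real" where
  "inv_part z \<beta> n v = exp (- \<beta> * real n) *
     (\<Sum>w\<in>words Inv n. wprob P w * norm (mprod M w *v v) powr z)"

text \<open>Boundedness in \<open>n\<close> says that the \<open>z\<close>-th moment of the norm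
  grows at exponential rate at most \<open>\<beta>\<close>.\<close>

definition moment :: "real \<Rightarrow> real \<Rightarrow> nat \<Rightarrow> real^2 \<Rightarrow> real" where
  "moment z \<beta> n v = exp (- \<beta> * real n) * markov_iter n (\<lambda>x. norm x powr z) v"

definition q :: real where "q = (\<Sum>i\<in>Inv. pmf P i)"

lemma pmf_pos: "i \<in> Sing \<union> Inv \<Longrightarrow> pmf P i > 0"
  using supp by (simp add: pmf_positive)

lemma q_pos: "0 < q"
  unfolding q_def using finite_Inv Inv_ne pmf_pos by (intro sum_pos) auto

lemma sum_pmf_Sing: "(\<Sum>s\<in>Sing. pmf P s) = 1 - q"
proof -
  have "(\<Sum>i\<in>Sing \<union> Inv. pmf P i) = 1"
    using supp finite_Sing finite_Inv by (intro sum_pmf_eq_1) auto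
  then show ?thesis using finite_Sing finite_Inv disj
    by (simp add: sum.union_disjoint q_def)
qed

lemma q_less_1: "q < 1"
proof -
  have "0 < (\<Sum>s\<in>Sing. pmf P s)" using finite_Sing Sing_ne pmf_pos by (intro sum_pos) auto
  then show ?thesis by (simp add: sum_pmf_Sing)
qed

lemma K_nonneg: "0 \<le> K"
proof -
  obtain s where "s \<in> Sing" using Sing_ne by blast
  then have "\<bar>ln (norm (mprod M [] *v r s))\<bar> \<le> K * (real 0 + 1)"
    by (intro ln_norm) (auto simp: words_def)
  then show ?thesis by (simp add: order_trans[OF abs_ge_zero])
qed

lemma markov_iter_0 [simp]: "markov_iter 0 f v = f v"
  by (simp add: markov_iter_def)

lemma sum_alphabet: "(\<Sum>i\<in>Sing \<union> Inv. F i) = (\<Sum>i\<in>Inv. F i) + (\<Sum>s\<in>Sing. F s)"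
  for F :: "nat \<Rightarrow> real"
  using finite_Sing finite_Inv disj by (simp add: sum.union_disjoint)

lemma markov_iter_Suc:
  "markov_iter (Suc n) f v = (\<Sum>i\<in>Sing \<union> Inv. pmf P i * markov_iter n f (M i *v v))"
  unfolding markov_iter_def sum_words_Suc
  by (simp only: mprod_Cons_vec wprob_Cons sum_distrib_left mult.assoc)

lemma markov_iter_nonneg: "(\<And>x. f x \<ge> 0) \<Longrightarrow> markov_iter n f v \<ge> 0"
  unfolding markov_iter_def by (intro sum_nonneg) auto

lemma moment_nonneg: "moment z \<beta> n v \<ge> 0"
  unfolding moment_def by (intro mult_nonneg_nonneg markov_iter_nonneg) auto

lemma moment_Suc:
  "moment z \<beta> (Suc n) v = (\<Sum>i\<in>Sing \<union> Inv. exp (- \<beta>) * pmf P i * moment z \<beta> n (M i *v v))"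
proof -
  have "exp (- \<beta> * real (Suc n)) = exp (- \<beta>) * exp (- \<beta> * real n)"
    by (simp add: algebra_simps flip: exp_add)
  then show ?thesis
    unfolding moment_def markov_iter_Suc sum_distrib_left by (auto intro!: sum.cong)
qed

text \<open>Homogeneity extends to \<open>c = 0\<close> because \<open>0 powr z = 0\<close>, even
  for negative \<open>z\<close>; a singular letter that annihilates \<open>v\<close> then needs no
  separate case.\<close>

lemma moment_scaleR: "moment z \<beta> n (c *\<^sub>R v) = \<bar>c\<bar> powr z * moment z \<beta> n v"
  unfolding moment_def markov_iter_def sum_distrib_left
  by (intro sum.cong) (auto simp: matrix_vector_mult_scaleR powr_mult)

lemma inv_part_Suc:
  "inv_part z \<beta> (Suc n) v = (\<Sum>i\<in>Inv. exp (- \<beta>) * pmf P i * inv_part z \<beta> n (M i *v v))"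
proof -
  have "exp (- \<beta> * real (Suc n)) = exp (- \<beta>) * exp (- \<beta> * real n)"
    by (simp add: algebra_simps flip: exp_add)
  then show ?thesis
    unfolding inv_part_def sum_words_Suc mprod_Cons_vec wprob_Cons sum_distrib_left
    by (auto intro!: sum.cong)
qed

lemma phi_0: "phi z \<beta> b 0 v = (\<Sum>s\<in>Sing. exp (- \<beta>) * pmf P s * (\<bar>wedge v (\<kappa> s)\<bar> powr z * b s))"
  unfolding phi_def by (simp add: sum_distrib_left algebra_simps)

lemma phi_Suc:
  "phi z \<beta> b (Suc m) v = (\<Sum>i\<in>Inv. exp (- \<beta>) * pmf P i * phi z \<beta> b m (M i *v v))"
proof -
  have "exp (- \<beta> * (real (Suc m) + 1)) = exp (- \<beta>) * exp (- \<beta> * (real m + 1))"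
    by (simp add: algebra_simps flip: exp_add)
  then show ?thesis
    unfolding phi_def sum_words_Suc mprod_Cons_vec wprob_Cons sum_distrib_left
    by (auto intro!: sum.cong)
qed

text \<open>Renewal equation: the first letter is either singular and ends the block, or invertible
  and leaves one letter less before the truncation.\<close>

lemma Phi_Suc:
  "Phi z \<beta> b (Suc n) v = phi z \<beta> b 0 v + (\<Sum>i\<in>Inv. exp (- \<beta>) * pmf P i * Phi z \<beta> b n (M i *v v))"
  unfolding Phi_def sum.lessThan_Suc_shift phi_Suc
  by (simp add: sum_distrib_left sum.swap[where B = Inv])

text \<open>Conditioning on the first singular letter: the hypothesis says that the bound \<open>C * b s\<close>
  reproduces itself at each renewal.\<close>

lemma moment_le_Phi:
  assumes "\<And>n s. s \<in> Sing \<Longrightarrow> inv_part z \<beta> n (r s) + C * Phi z \<beta> b n (r s) \<le> C * b s"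
  shows "moment z \<beta> n v \<le> inv_part z \<beta> n v + C * Phi z \<beta> b n v"
proof (induction n arbitrary: v)
  case 0
  then show ?case by (simp add: moment_def inv_part_def Phi_def)
next
  case (Suc n)
  have "moment z \<beta> (Suc n) v = (\<Sum>i\<in>Inv. exp (- \<beta>) * pmf P i * moment z \<beta> n (M i *v v))
      + (\<Sum>s\<in>Sing. exp (- \<beta>) * pmf P s * moment z \<beta> n (M s *v v))"
    unfolding moment_Suc by (rule sum_alphabet)
  \<comment> \<open>For a singular letter, \<open>M s *v v\<close> is a multiple of
    \<open>r s\<close>: homogeneity extracts the scalar, and the hypothesis at \<open>r s\<close>
    bounds what remains by \<open>C * b s\<close>.\<close>
  also have "\<dots> \<le> (\<Sum>i\<in>Inv. exp (- \<beta>) * pmf P i * (inv_part z \<beta> n (M i *v v) + C * Phi z \<beta> b n (M i *v v)))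
      + (\<Sum>s\<in>Sing. exp (- \<beta>) * pmf P s * (\<bar>wedge v (\<kappa> s)\<bar> powr z * (C * b s)))"
    using order_trans[OF Suc.IH assms]
    by (intro add_mono sum_mono mult_left_mono Suc.IH) (auto simp: M_Sing moment_scaleR intro!: mult_left_mono)
  also have "\<dots> = inv_part z \<beta> (Suc n) v + C * Phi z \<beta> b (Suc n) v"
    unfolding inv_part_Suc Phi_Suc phi_0
    by (simp add: sum.distrib sum_distrib_left algebra_simps)
  finally show ?case .
qed

section \<open>Mean gain of a block and its centring\<close>

definition log_coeff :: "nat \<Rightarrow> nat \<Rightarrow> real" where
  "log_coeff s n = (\<Sum>w\<in>words Inv n. \<Sum>s'\<in>Sing.
     wprob P w * pmf P s' * ln \<bar>wedge (mprod M w *v r s) (\<kappa> s')\<bar>)"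

text \<open>The expected logarithmic gain between two consecutive singular letters, the first being \<open>s\<close>.\<close>
definition gain :: "nat \<Rightarrow> real" where
  "gain s = (\<Sum>n. log_coeff s n)"

text \<open>The mean gain per block over the mean block length: blocks last \<open>1 / (1 - q)\<close> steps on average
  and start at \<open>s\<close> with probability \<open>pmf P s / (1 - q)\<close>, so the factors \<open>1 - q\<close> cancel.\<close>
definition lyap :: real where
  "lyap = (\<Sum>s\<in>Sing. pmf P s * gain s)"

text \<open>Solves the Poisson equation: \<open>exp (z * corr s)\<close> cancels the first-order dependence on the
  starting letter in \<open>moment_bounded\<close>.\<close>

definition corr :: "nat \<Rightarrow> real" where
  "corr s = gain s - lyap / (1 - q)"

text \<open>The letter that ends a block is independent of the invertible letters before it, so this
  centring removes its correction from the first-order term in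
  \<open>moment_bounded\<close>.\<close>

lemma sum_pmf_corr: "(\<Sum>s\<in>Sing. pmf P s * corr s) = 0"
proof -
  have "(\<Sum>s\<in>Sing. pmf P s * corr s) = lyap - (\<Sum>s\<in>Sing. pmf P s) * (lyap / (1 - q))"
    unfolding corr_def right_diff_distrib sum_subtractf sum_distrib_right lyap_def ..
  then show ?thesis using q_less_1 by (simp add: sum_pmf_Sing)
qed

lemma sum_block: "(\<Sum>w\<in>words Inv n. \<Sum>s\<in>Sing. wprob P w * pmf P s * c s) = q ^ n * (\<Sum>s\<in>Sing. pmf P s * c s)"
  by (simp add: q_def sum_product flip: sum_wprob_words) (simp add: mult.assoc)

lemma sum_block_const: "(\<Sum>w\<in>words Inv n. \<Sum>s\<in>Sing. wprob P w * pmf P s * c) = q ^ n * (1 - q) * c"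
  unfolding sum_block by (simp add: sum_pmf_Sing flip: sum_distrib_right)

text \<open>Mean length of a block, its final singular letter included.\<close>

lemma sums_Suc_q: "(\<lambda>n. (real n + 1) * (q ^ n * (1 - q))) sums (1 / (1 - q))"
  using sums_mult[OF geometric_deriv_sums[of q], of "1 - q"] q_pos q_less_1
  by (simp add: power2_eq_square mult_ac add.commute)

text \<open>Logarithms grow at most linearly in the block length, which the geometric weight of long
  blocks makes summable.\<close>

lemma log_coeff_sums:
  assumes "s \<in> Sing"
  shows "log_coeff s sums gain s"
proof -
  have "norm (log_coeff s n) \<le> K * ((real n + 1) * (q ^ n * (1 - q)))" for n
  proof -
    have "norm (log_coeff s n) \<le> (\<Sum>w\<in>words Inv n. \<Sum>s'\<in>Sing. wprob P w * pmf P s' * (K * (real n + 1)))"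
      unfolding log_coeff_def real_norm_def
      by (intro order_trans[OF sum_abs] sum_mono) (auto simp: abs_mult intro!: mult_left_mono ln_wedge assms)
    then show ?thesis unfolding sum_block_const by (simp add: mult_ac)
  qed
  then have "summable (log_coeff s)"
    by (rule summable_comparison_test'[OF summable_mult[OF sums_summable[OF sums_Suc_q]]])
  then show ?thesis unfolding gain_def by (rule summable_sums)
qed

text \<open>With \<open>b s = exp (z * corr s)\<close>, a second-order expansion of each block
  factor bounds \<open>Phi\<close> at \<open>r s\<close> by \<open>b s - \<eta>\<close>, whatever
  the truncation. Zeroth-order terms sum to 1, first-order terms to
  \<open>z * corr s - 2 * \<eta>\<close>, and the quadratic error is at most \<open>\<eta>\<close>
  for small \<open>z\<close>. The gap \<open>\<eta>\<close> pays for
  \<open>inv_part\<close>.\<close>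

lemma moment_bounded:
  assumes \<delta>: "0 < \<delta>" "\<delta> \<le> 1"
  obtains z0 where "z0 > 0"
    "\<And>z s. \<bar>z\<bar> = z0 \<Longrightarrow> s \<in> Sing \<Longrightarrow> \<exists>C. \<forall>n. moment z (z * lyap + \<delta> * \<bar>z\<bar>) n (r s) \<le> C"
proof -
  \<comment> \<open>Collects the bounds on \<open>corr\<close>, on the logarithmic gain and on
    \<open>\<beta>\<close>, so that the exponent of a block with \<open>m\<close> invertible letters
    is at most \<open>z0 * J * (m + 1)\<close> in modulus.\<close>
  define J where "J = K + \<bar>lyap\<bar> + 1 + (\<Sum>s\<in>Sing. \<bar>corr s\<bar>)"
  have J: "J > 0" unfolding J_def using K_nonneg by (simp add: add_nonneg_pos add_pos_nonneg sum_nonneg)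
  \<comment> \<open>Makes \<open>\<rho>\<close> the square root of \<open>q\<close>: block lengths
    still have a finite exponential moment at rate \<open>2 * \<zeta> * J\<close>.\<close>
  define \<zeta> where "\<zeta> = ln (1 / q) / (4 * J)"
  have \<zeta>: "\<zeta> > 0" using J q_pos q_less_1 by (simp add: \<zeta>_def)
  define \<rho> where "\<rho> = exp (2 * \<zeta> * J) * q"
  have "2 * \<zeta> * J = ln (1 / q) / 2" using J by (simp add: \<zeta>_def)
  then have "2 * \<zeta> * J + ln q < 0" using q_pos q_less_1 by (simp add: ln_div)
  then have \<rho>: "0 < \<rho>" "\<rho> < 1"
    using q_pos by (auto simp: \<rho>_def exp_add simp flip: exp_less_one_iff)
  \<comment> \<open>Coefficient of \<open>(z / \<zeta>)\<^sup>2\<close> in the total quadratic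
    error, a geometric series of ratio \<open>\<rho>\<close>.\<close>
  define H where "H = 2 * exp (2 * \<zeta> * J) * (1 - q) / (1 - \<rho>)"
  have H: "H > 0" using q_less_1 \<rho> by (simp add: H_def)
  \<comment> \<open>The second bound makes the quadratic error
    \<open>z0\<^sup>2 * H / \<zeta>\<^sup>2\<close> at most \<open>\<eta>\<close>.\<close>
  define z0 where "z0 = min \<zeta> (\<delta> * \<zeta>\<^sup>2 / (2 * H * (1 - q)))"
  have z0: "z0 > 0" "z0 \<le> \<zeta>" using \<zeta> \<delta> H q_less_1 by (auto simp: z0_def)
  have exp_rho: "exp (2 * \<zeta> * (J * (real n + 1))) * q ^ n = exp (2 * \<zeta> * J) * \<rho> ^ n" for n
    by (simp add: \<rho>_def power_mult_distrib algebra_simps flip: exp_of_nat_mult exp_add)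
  show thesis
  proof (rule that[OF z0(1)])
    fix z :: real and s assume z: "\<bar>z\<bar> = z0" and s: "s \<in> Sing"
    define \<beta> where "\<beta> = z * lyap + \<delta> * \<bar>z\<bar>"
    define b where "b = (\<lambda>s. exp (z * corr s))"
    define \<eta> where "\<eta> = \<delta> * z0 / (2 * (1 - q))"
    have \<eta>: "\<eta> > 0" using \<delta> z0 q_less_1 by (simp add: \<eta>_def)
    have corr_le: "\<bar>corr s'\<bar> \<le> (\<Sum>s\<in>Sing. \<bar>corr s\<bar>)" if "s' \<in> Sing" for s'
      by (rule member_le_sum) (auto simp: that finite_Sing)
    have \<beta>_le: "\<bar>\<beta>\<bar> \<le> z0 * (\<bar>lyap\<bar> + 1)"
    proof -
      have "\<bar>\<beta>\<bar> \<le> \<bar>z\<bar> * \<bar>lyap\<bar> + \<delta> * \<bar>z\<bar>"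
        unfolding \<beta>_def using \<delta> by (intro order_trans[OF abs_triangle_ineq]) (simp add: abs_mult)
      also have "\<delta> * \<bar>z\<bar> \<le> 1 * \<bar>z\<bar>" using \<delta> by (intro mult_right_mono) auto
      finally show ?thesis using z by (simp add: algebra_simps)
    qed
    \<comment> \<open>One exponential absorbs the square,
      \<open>(\<zeta> * y)\<^sup>2 \<le> 2 * exp (\<zeta> * y)\<close>, and
      \<open>exp \<bar>X\<bar>\<close> costs another; hence the rate
      \<open>2 * \<zeta>\<close>.\<close>
    have X_le: "exp X \<le> 1 + X + (z / \<zeta>)\<^sup>2 * (2 * exp (2 * \<zeta> * (J * (real n + 1))))"
      if "\<bar>X\<bar> \<le> z0 * (J * (real n + 1))" for X n
    proof -
      define y where "y = J * (real n + 1)"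
      have y: "y \<ge> 0" using J by (simp add: y_def)
      have "X\<^sup>2 \<le> (z0 * y)\<^sup>2"
        using that by (simp add: y_def abs_le_square_iff[symmetric])
      also have "\<dots> = (z / \<zeta>)\<^sup>2 * (\<zeta> * y)\<^sup>2"
        using z \<zeta> by (auto simp: power_mult_distrib power_divide)
      also have "\<dots> \<le> (z / \<zeta>)\<^sup>2 * (2 * exp (\<zeta> * y))"
      proof (rule mult_left_mono)
        have "0 \<le> \<zeta> * y" using \<zeta> y by simp
        then show "(\<zeta> * y)\<^sup>2 \<le> 2 * exp (\<zeta> * y)"
          using exp_lower_Taylor_quadratic[of "\<zeta> * y"] by linarith
      qed simp
      finally have "X\<^sup>2 \<le> (z / \<zeta>)\<^sup>2 * (2 * exp (\<zeta> * y))" .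
      moreover have "\<bar>X\<bar> \<le> \<zeta> * y"
        using that mult_right_mono[OF z0(2) y] by (simp add: y_def)
      ultimately have "X\<^sup>2 * exp \<bar>X\<bar> \<le> (z / \<zeta>)\<^sup>2 * (2 * exp (\<zeta> * y)) * exp (\<zeta> * y)"
        by (intro mult_mono) auto
      also have "\<dots> = (z / \<zeta>)\<^sup>2 * (2 * exp (2 * \<zeta> * y))"
        by (simp add: algebra_simps flip: exp_add)
      finally show ?thesis using exp_le_quadratic[of X] by (simp add: y_def)
    qed
    have Phi_le: "Phi z \<beta> b n (r s) \<le> b s - \<eta>" if s: "s \<in> Sing" for n s
    proof -
      define d where "d = (\<lambda>n. q ^ n * (1 - q) + z * log_coeff s n
        - \<beta> * ((real n + 1) * (q ^ n * (1 - q))) + (z / \<zeta>)\<^sup>2 * (2 * exp (2 * \<zeta> * J) * (1 - q)) * \<rho> ^ n)"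
      have phi_nonneg: "0 \<le> phi z \<beta> b m (r s)" for m
        unfolding phi_def b_def by (intro mult_nonneg_nonneg sum_nonneg) auto
      have phi_le: "phi z \<beta> b m (r s) \<le> d m" for m
      proof -
        define X where "X = (\<lambda>w s'. z * corr s' + z * ln \<bar>wedge (mprod M w *v r s) (\<kappa> s')\<bar> - \<beta> * (real m + 1))"
        have X: "\<bar>X w s'\<bar> \<le> z0 * (J * (real m + 1))" if "w \<in> words Inv m" "s' \<in> Sing" for w s'
        proof -
          have "\<bar>X w s'\<bar> \<le> z0 * \<bar>corr s'\<bar> + z0 * \<bar>ln \<bar>wedge (mprod M w *v r s) (\<kappa> s')\<bar>\<bar> + \<bar>\<beta>\<bar> * (real m + 1)"
            unfolding X_def z[symmetric] abs_mult[symmetric]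
            using abs_mult[of \<beta> "real m + 1"] by (simp del: abs_mult)
          also have "\<dots> \<le> z0 * ((\<Sum>s\<in>Sing. \<bar>corr s\<bar>) * (real m + 1)) + z0 * (K * (real m + 1))
             + (z0 * (\<bar>lyap\<bar> + 1)) * (real m + 1)"
          proof (intro add_mono mult_left_mono mult_right_mono)
            have "(\<Sum>s\<in>Sing. \<bar>corr s\<bar>) * 1 \<le> (\<Sum>s\<in>Sing. \<bar>corr s\<bar>) * (real m + 1)"
              by (intro mult_left_mono sum_nonneg) auto
            then show "\<bar>corr s'\<bar> \<le> (\<Sum>s\<in>Sing. \<bar>corr s\<bar>) * (real m + 1)"
              using corr_le[OF that(2)] by linarith
          qed (use z0 \<beta>_le ln_wedge s that in auto)
          also have "\<dots> = z0 * (J * (real m + 1))" by (simp add: J_def algebra_simps)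
          finally show ?thesis .
        qed
        have "phi z \<beta> b m (r s) = (\<Sum>w\<in>words Inv m. \<Sum>s'\<in>Sing. wprob P w * pmf P s' * exp (X w s'))"
          unfolding phi_def sum_distrib_left
          using wedge_nz[OF s] by (intro sum.cong refl) (auto simp: b_def X_def powr_def exp_diff exp_add exp_minus field_simps)
        also have "\<dots> \<le> (\<Sum>w\<in>words Inv m. \<Sum>s'\<in>Sing. wprob P w * pmf P s' *
            (1 + X w s' + (z / \<zeta>)\<^sup>2 * (2 * exp (2 * \<zeta> * (J * (real m + 1))))))"
          by (intro sum_mono mult_left_mono X_le X) auto
        also have "\<dots> = (\<Sum>w\<in>words Inv m. \<Sum>s'\<in>Sing. wprob P w * pmf P s' *
              (1 - \<beta> * (real m + 1) + (z / \<zeta>)\<^sup>2 * (2 * exp (2 * \<zeta> * (J * (real m + 1))))))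
            + z * (\<Sum>w\<in>words Inv m. \<Sum>s'\<in>Sing. wprob P w * pmf P s' * corr s') + z * log_coeff s m"
          unfolding log_coeff_def X_def sum_distrib_left sum.distrib[symmetric]
          by (intro sum.cong refl) (simp add: algebra_simps)
        also have "\<dots> = q ^ m * (1 - q) * (1 - \<beta> * (real m + 1)) +
           (z / \<zeta>)\<^sup>2 * 2 * (1 - q) * (exp (2 * \<zeta> * (J * (real m + 1))) * q ^ m) + z * log_coeff s m"
          unfolding sum_block_const sum_block sum_pmf_corr by (simp add: algebra_simps)
        also have "\<dots> = d m" unfolding exp_rho d_def by (simp add: algebra_simps)
        finally show ?thesis .
      qed
      have geo: "(\<lambda>n. q ^ n * (1 - q)) sums 1"
        using sums_mult2[OF geometric_sums[of q], of "1 - q"] q_pos q_less_1 by simp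
      have "d sums (1 + z * gain s - \<beta> * (1 / (1 - q)) + (z / \<zeta>)\<^sup>2 * (2 * exp (2 * \<zeta> * J) * (1 - q)) * (1 / (1 - \<rho>)))"
        unfolding d_def using \<rho>
        by (intro sums_add sums_diff sums_mult geo sums_Suc_q log_coeff_sums geometric_sums s) auto
      then have d: "d sums (1 + z * gain s - \<beta> / (1 - q) + (z / \<zeta>)\<^sup>2 * H)"
        by (simp add: H_def)
      have "Phi z \<beta> b n (r s) \<le> (\<Sum>m<n. d m)"
        unfolding Phi_def by (intro sum_mono phi_le)
      \<comment> \<open>The terms of \<open>d\<close> are nonnegative because they dominate those of
        \<open>phi\<close>.\<close>
      also have "\<dots> \<le> suminf d"
        using phi_nonneg phi_le by (intro sum_le_suminf sums_summable[OF d]) (auto intro: order_trans)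
      also have "\<dots> = 1 + z * gain s - \<beta> / (1 - q) + (z / \<zeta>)\<^sup>2 * H"
        using d by (rule sums_unique[symmetric])
      also have "\<dots> = 1 + z * corr s - 2 * \<eta> + z0 * (z0 * H / \<zeta>\<^sup>2)"
      proof -
        \<comment> \<open>The \<open>lyap\<close> part turns \<open>gain s\<close> into
          \<open>corr s\<close>; the surplus \<open>\<delta> * \<bar>z\<bar>\<close> in
          \<open>\<beta>\<close> leaves \<open>2 * \<eta>\<close>.\<close>
        have "\<beta> / (1 - q) = z * (lyap / (1 - q)) + 2 * \<eta>"
        proof -
          have "\<delta> * z0 / (1 - q) = 2 * \<eta>" using q_less_1 by (simp add: \<eta>_def field_simps)
          then show ?thesis using z by (simp add: \<beta>_def add_divide_distrib)
        qed
        moreover have "z\<^sup>2 = z0 * z0" using z by (simp flip: z power2_eq_square)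
        then have "(z / \<zeta>)\<^sup>2 * H = z0 * (z0 * H / \<zeta>\<^sup>2)" by (simp add: power_divide)
        ultimately show ?thesis by (simp add: corr_def right_diff_distrib)
      qed
      also have "z0 * (z0 * H / \<zeta>\<^sup>2) \<le> \<eta>"
      proof -
        have "z0 \<le> \<delta> * \<zeta>\<^sup>2 / (2 * H * (1 - q))" by (simp add: z0_def)
        then have "z0 * H / \<zeta>\<^sup>2 \<le> \<delta> / (2 * (1 - q))"
          using \<zeta> H q_less_1 by (simp add: field_simps)
        from mult_left_mono[OF this, of z0] show ?thesis using z0 by (simp add: \<eta>_def algebra_simps)
      qed
      also have "1 + z * corr s \<le> b s" unfolding b_def by (rule exp_ge_add_one_self)
      finally show ?thesis by simp
    qed
    have inv_le: "inv_part z \<beta> n (r s) \<le> exp (2 * \<zeta> * J)" if s: "s \<in> Sing" for n s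
    proof -
      have le: "exp (- \<beta> * real n) * norm (mprod M w *v r s) powr z \<le> exp (2 * \<zeta> * (J * (real n + 1)))"
        if w: "w \<in> words Inv n" for w
      proof -
        obtain s' where s': "s' \<in> Sing" using Sing_ne by blast
        have "mprod M w *v r s \<noteq> 0" using wedge_nz[OF s s' w] by (auto simp: wedge_def)
        then have "exp (- \<beta> * real n) * norm (mprod M w *v r s) powr z
            = exp (- \<beta> * real n + z * ln (norm (mprod M w *v r s)))"
          by (simp add: powr_def flip: exp_add)
        also have "\<dots> \<le> exp (2 * \<zeta> * (J * (real n + 1)))"
        proof (subst exp_le_cancel_iff)
          have "- \<beta> * real n \<le> \<bar>\<beta>\<bar> * (real n + 1)"
            by (rule order_trans[OF abs_ge_self]) (simp add: abs_mult algebra_simps)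
          moreover have "\<bar>\<beta>\<bar> * (real n + 1) \<le> z0 * (\<bar>lyap\<bar> + 1) * (real n + 1)"
            by (intro mult_right_mono \<beta>_le) auto
          moreover have "z * ln (norm (mprod M w *v r s)) \<le> z0 * \<bar>ln (norm (mprod M w *v r s))\<bar>"
            unfolding z[symmetric] abs_mult[symmetric] by linarith
          moreover have "\<dots> \<le> z0 * (K * (real n + 1))"
            using z0 by (intro mult_left_mono ln_norm s w) auto
          ultimately have "- \<beta> * real n + z * ln (norm (mprod M w *v r s))
              \<le> z0 * ((K + \<bar>lyap\<bar> + 1) * (real n + 1))" by (simp add: algebra_simps)
          also have "\<dots> \<le> (2 * \<zeta>) * (J * (real n + 1))"
            using z0 \<zeta> K_nonneg by (intro mult_mono) (auto simp: J_def intro!: sum_nonneg)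
          finally show "- \<beta> * real n + z * ln (norm (mprod M w *v r s)) \<le> 2 * \<zeta> * (J * (real n + 1))"
            by simp
        qed
        finally show ?thesis .
      qed
      have "inv_part z \<beta> n (r s) = (\<Sum>w\<in>words Inv n. wprob P w * (exp (- \<beta> * real n) * norm (mprod M w *v r s) powr z))"
        unfolding inv_part_def sum_distrib_left by (simp add: algebra_simps)
      also have "\<dots> \<le> (\<Sum>w\<in>words Inv n. wprob P w * exp (2 * \<zeta> * (J * (real n + 1))))"
        by (intro sum_mono mult_left_mono le) auto
      also have "\<dots> = exp (2 * \<zeta> * (J * (real n + 1))) * q ^ n"
        by (simp add: sum_wprob_words q_def flip: sum_distrib_right)
      also have "\<dots> = exp (2 * \<zeta> * J) * \<rho> ^ n" by (rule exp_rho)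
      also have "\<dots> \<le> exp (2 * \<zeta> * J) * 1" using \<rho> by (intro mult_left_mono power_le_one) auto
      finally show ?thesis by simp
    qed
    \<comment> \<open>Chosen so that the gap \<open>C * \<eta>\<close> equals the bound on
      \<open>inv_part\<close>.\<close>
    define C where "C = exp (2 * \<zeta> * J) / \<eta>"
    have C: "C \<ge> 0" "C * \<eta> = exp (2 * \<zeta> * J)" using \<eta> by (auto simp: C_def)
    have key: "inv_part z \<beta> n (r s) + C * Phi z \<beta> b n (r s) \<le> C * b s" if "s \<in> Sing" for n s
      using inv_le[OF that, of n] mult_left_mono[OF Phi_le[OF that, of n] C(1)] C(2)
      by (simp add: algebra_simps)
    have "moment z \<beta> n (r s) \<le> C * b s" for n
      using moment_le_Phi[of z \<beta> C b n "r s", OF key] key[OF s, of n] by linarith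
    then show "\<exists>C. \<forall>n. moment z (z * lyap + \<delta> * \<bar>z\<bar>) n (r s) \<le> C"
      unfolding \<beta>_def by blast
  qed
qed

definition start :: "real^2 \<Rightarrow> bool" where
  "start v \<longleftrightarrow> (\<exists>c s m w. c \<noteq> 0 \<and> s \<in> Sing \<and> w \<in> words Inv m \<and> v = c *\<^sub>R (mprod M w *v r s))"

lemma start_nz: "start v \<Longrightarrow> v \<noteq> 0"
  using wedge_nz Sing_ne by (fastforce simp: start_def wedge_def)

lemma start_step:
  assumes "start v" "i \<in> Sing \<union> Inv"
  shows "start (M i *v v)"
proof -
  obtain c s m w where v: "c \<noteq> 0" "s \<in> Sing" "w \<in> words Inv m" "v = c *\<^sub>R (mprod M w *v r s)"
    using assms(1) by (auto simp: start_def)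
  show ?thesis
  proof (cases "i \<in> Sing")
    case True
    then have "M i *v v = (c * wedge (mprod M w *v r s) (\<kappa> i)) *\<^sub>R (mprod M [] *v r i)"
      by (simp add: v(4) M_Sing)
    moreover have "c * wedge (mprod M w *v r s) (\<kappa> i) \<noteq> 0" using v wedge_nz True by simp
    moreover have "[] \<in> words Inv 0" by simp
    ultimately show ?thesis unfolding start_def using True by metis
  next
    case False
    then have "M i *v v = c *\<^sub>R (mprod M (w @ [i]) *v r s)" "w @ [i] \<in> words Inv (Suc m)"
      using assms(2) v(3) by (auto simp: v(4) mprod_append_vec matrix_vector_mult_scaleR words_def)
    then show ?thesis unfolding start_def using v by metis
  qed
qed

lemma start_mprod: "start v \<Longrightarrow> set w \<subseteq> Sing \<union> Inv \<Longrightarrow> start (mprod M w *v v)"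
  by (induction w arbitrary: v) (auto simp: mprod_Cons_vec start_step simp del: mprod.simps(2))

text \<open>Keeps only the words that begin with \<open>w\<close>. When \<open>w\<close> has
  positive probability, a bound on \<open>moment\<close> at \<open>v\<close> thus passes to
  \<open>mprod M w *v v\<close>.\<close>

lemma moment_shift:
  "set w \<subseteq> Sing \<union> Inv \<Longrightarrow>
    wprob P w * exp (- \<beta> * real (length w)) * moment z \<beta> n (mprod M w *v v) \<le> moment z \<beta> (n + length w) v"
proof (induction w arbitrary: v)
  case (Cons i w)
  have "exp (- \<beta> * real (length (i # w))) = exp (- \<beta>) * exp (- \<beta> * real (length w))"
    by (simp add: algebra_simps flip: exp_add)
  then have "wprob P (i # w) * exp (- \<beta> * real (length (i # w))) * moment z \<beta> n (mprod M (i # w) *v v)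
      = exp (- \<beta>) * pmf P i * (wprob P w * exp (- \<beta> * real (length w)) * moment z \<beta> n (mprod M w *v (M i *v v)))"
    by (simp only: mprod_Cons_vec wprob_Cons mult_ac)
  also have "\<dots> \<le> exp (- \<beta>) * pmf P i * moment z \<beta> (n + length w) (M i *v v)"
    using Cons by (intro mult_left_mono) auto
  also have "\<dots> \<le> moment z \<beta> (Suc (n + length w)) v"
    unfolding moment_Suc using Cons.prems finite_Sing finite_Inv
    by (intro member_le_sum) (auto simp: moment_nonneg)
  finally show ?case by simp
qed simp

lemma wprob_pos: "set w \<subseteq> Sing \<union> Inv \<Longrightarrow> wprob P w > 0"
  by (induction w) (auto simp: pmf_pos)

lemma moment_bounded_start:
  assumes "start v" and bounded: "\<And>s. s \<in> Sing \<Longrightarrow> \<exists>C. \<forall>n. moment z \<beta> n (r s) \<le> C"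
  shows "\<exists>C. \<forall>n. moment z \<beta> n v \<le> C"
proof -
  obtain c s m w where v: "c \<noteq> 0" "s \<in> Sing" "w \<in> words Inv m" "v = c *\<^sub>R (mprod M w *v r s)"
    using assms(1) by (auto simp: start_def)
  have w: "set w \<subseteq> Sing \<union> Inv" using v(3) by (auto simp: words_def)
  obtain C where C: "\<And>n. moment z \<beta> n (r s) \<le> C" using bounded[OF v(2)] by blast
  define a where "a = wprob P w * exp (- \<beta> * real (length w))"
  have a: "a > 0" using wprob_pos[OF w] by (simp add: a_def)
  have "moment z \<beta> n v \<le> \<bar>c\<bar> powr z * (C / a)" for n
  proof -
    have "a * moment z \<beta> n (mprod M w *v r s) \<le> C"
      unfolding a_def by (rule order_trans[OF moment_shift[OF w] C])
    then have "moment z \<beta> n (mprod M w *v r s) \<le> C / a" using a by (simp add: field_simps)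
    then show ?thesis unfolding v(4) moment_scaleR by (intro mult_left_mono) auto
  qed
  then show ?thesis by blast
qed

section \<open>Exponential deviation bounds and the value of \<open>L1\<close>\<close>

lemma measure_pre_markov:
  "measure (bernoulli P) {\<omega>. Q (pre n \<omega>)} = (\<Sum>w\<in>words (Sing \<union> Inv) n. wprob P w * of_bool (Q w))"
  using measure_pre[of P Q n] finite_Sing finite_Inv by (simp add: supp)

text \<open>Exponential Chebyshev inequality with exponents \<open>z0\<close> and
  \<open>- z0\<close>, for deviations above and below \<open>lyap\<close>. The moment bounds lose
  \<open>\<delta> * z0\<close> in the exponent, and the rate
  \<open>z0 * (\<epsilon> - \<delta>)\<close> remains.\<close>

lemma vector_large_deviations:
  assumes v: "start v" and \<epsilon>: "\<epsilon> > 0"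
  obtains C c where "c > 0" "\<And>n. n \<ge> 1 \<Longrightarrow> measure (bernoulli P)
    {\<omega>. deviates n (norm (cocycle M n \<omega> *v v)) (ereal lyap) \<epsilon>} \<le> C * exp (- c * real n)"
proof -
  define \<delta> where "\<delta> = min 1 (\<epsilon> / 2)"
  have \<delta>: "0 < \<delta>" "\<delta> \<le> 1" "\<delta> < \<epsilon>" using \<epsilon> by (auto simp: \<delta>_def)
  obtain z0 where z0: "z0 > 0"
    "\<And>z s. \<bar>z\<bar> = z0 \<Longrightarrow> s \<in> Sing \<Longrightarrow> \<exists>C. \<forall>n. moment z (z * lyap + \<delta> * \<bar>z\<bar>) n (r s) \<le> C"
    using moment_bounded[OF \<delta>(1,2)] by blast
  obtain C1 where C1: "\<And>n. moment z0 (z0 * lyap + \<delta> * z0) n v \<le> C1"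
    using moment_bounded_start[OF v, of z0 "z0 * lyap + \<delta> * z0"] z0(2)[of z0] z0(1) by auto
  obtain C2 where C2: "\<And>n. moment (- z0) (- z0 * lyap + \<delta> * z0) n v \<le> C2"
    using moment_bounded_start[OF v, of "- z0" "- z0 * lyap + \<delta> * z0"] z0(2)[of "- z0"] z0(1) by auto
  show thesis
  proof (rule that)
    show "z0 * (\<epsilon> - \<delta>) > 0" using z0 \<delta> by simp
    fix n :: nat assume n: "n \<ge> 1"
    define p where "p = (\<lambda>w. exp (- z0 * real n * (lyap + \<epsilon>)) * norm (mprod M w *v v) powr z0
      + exp (z0 * real n * (lyap - \<epsilon>)) * norm (mprod M w *v v) powr (- z0))"
    have le: "of_bool (deviates n (norm (mprod M w *v v)) (ereal lyap) \<epsilon>) \<le> p w"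
      if "w \<in> words (Sing \<union> Inv) n" for w
    proof (cases "deviates n (norm (mprod M w *v v)) (ereal lyap) \<epsilon>")
      case True
      define x where "x = norm (mprod M w *v v)"
      \<comment> \<open>\<open>start\<close> excludes the value 0, for which \<open>deviates\<close>
        holds with no condition on the logarithm.\<close>
      have x: "x > 0" using start_nz[OF start_mprod[OF v]] that by (auto simp: words_def x_def)
      have p: "p w = exp (z0 * (ln x - real n * (lyap + \<epsilon>))) + exp (z0 * (real n * (lyap - \<epsilon>) - ln x))"
        using x unfolding p_def x_def[symmetric] by (simp add: powr_def algebra_simps flip: exp_add)
      from True x have "\<bar>ln x / real n - lyap\<bar> > \<epsilon>" by (simp add: deviates_def x_def[symmetric])
      then consider "ln x / real n \<ge> lyap + \<epsilon>" | "ln x / real n \<le> lyap - \<epsilon>" by linarith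
      then show ?thesis
      proof cases
        case 1
        then have "ln x - real n * (lyap + \<epsilon>) \<ge> 0" using n by (simp add: field_simps)
        then have "z0 * (ln x - real n * (lyap + \<epsilon>)) \<ge> 0" using z0(1) by (simp only: mult_nonneg_nonneg less_imp_le)
        then have "exp (z0 * (ln x - real n * (lyap + \<epsilon>))) \<ge> 1" by simp
        then show ?thesis unfolding p using True by (simp add: add_increasing2)
      next
        case 2
        then have "real n * (lyap - \<epsilon>) - ln x \<ge> 0" using n by (simp add: field_simps)
        then have "z0 * (real n * (lyap - \<epsilon>) - ln x) \<ge> 0" using z0(1) by (simp only: mult_nonneg_nonneg less_imp_le)
        then have "exp (z0 * (real n * (lyap - \<epsilon>) - ln x)) \<ge> 1" by simp
        then show ?thesis unfolding p using True by (simp add: add_increasing)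
      qed
    qed (simp add: p_def)
    have "measure (bernoulli P) {\<omega>. deviates n (norm (cocycle M n \<omega> *v v)) (ereal lyap) \<epsilon>}
        = (\<Sum>w\<in>words (Sing \<union> Inv) n. wprob P w * of_bool (deviates n (norm (mprod M w *v v)) (ereal lyap) \<epsilon>))"
      unfolding cocycle_pre by (rule measure_pre_markov)
    also have "\<dots> \<le> (\<Sum>w\<in>words (Sing \<union> Inv) n. wprob P w * p w)"
      by (intro sum_mono mult_left_mono le) auto
    also have "\<dots> = exp (- z0 * real n * (lyap + \<epsilon>)) * markov_iter n (\<lambda>x. norm x powr z0) v
        + exp (z0 * real n * (lyap - \<epsilon>)) * markov_iter n (\<lambda>x. norm x powr (- z0)) v"
      unfolding markov_iter_def p_def sum_distrib_left sum.distrib[symmetric]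
      by (intro sum.cong) (auto simp: algebra_simps)
    also have "\<dots> = exp (- (z0 * (\<epsilon> - \<delta>)) * real n) * moment z0 (z0 * lyap + \<delta> * z0) n v
        + exp (- (z0 * (\<epsilon> - \<delta>)) * real n) * moment (- z0) (- z0 * lyap + \<delta> * z0) n v"
      unfolding moment_def mult.assoc[symmetric] exp_add[symmetric] by (simp add: algebra_simps)
    also have "\<dots> \<le> exp (- (z0 * (\<epsilon> - \<delta>)) * real n) * C1 + exp (- (z0 * (\<epsilon> - \<delta>)) * real n) * C2"
      by (intro add_mono mult_left_mono C1 C2) auto
    finally show "measure (bernoulli P) {\<omega>. deviates n (norm (cocycle M n \<omega> *v v)) (ereal lyap) \<epsilon>}
        \<le> (C1 + C2) * exp (- (z0 * (\<epsilon> - \<delta>)) * real n)" by (simp add: algebra_simps)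
  qed
qed

text \<open>\<open>mnorm\<close> is comparable to the larger of the norms on \<open>v1\<close> and
  \<open>v2\<close>; passing from \<open>\<epsilon>\<close> to \<open>\<epsilon> / 2\<close> leaves
  room for the constants once \<open>n\<close> is large. The lower bound uses \<open>v1\<close>
  alone.\<close>

lemma norm_large_deviations:
  assumes v: "start v1" "start v2" "wedge v1 v2 \<noteq> 0" and \<epsilon>: "\<epsilon> > 0"
  shows "\<exists>C. \<exists>c>0. \<exists>N. \<forall>n\<ge>N. measure (bernoulli P)
    {\<omega>. deviates n (mnorm (cocycle M n \<omega>)) (ereal lyap) \<epsilon>} \<le> C * exp (- c * real n)"
proof -
  interpret bern: prob_space "bernoulli P" by (rule prob_space_bernoulli)
  have half: "\<epsilon> / 2 > 0" using \<epsilon> by simp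
  obtain C1 c1 where 1: "c1 > 0" "\<And>n. n \<ge> 1 \<Longrightarrow> measure (bernoulli P)
    {\<omega>. deviates n (norm (cocycle M n \<omega> *v v1)) (ereal lyap) (\<epsilon> / 2)} \<le> C1 * exp (- c1 * real n)"
    using vector_large_deviations[OF v(1) half] by blast
  obtain C2 c2 where 2: "c2 > 0" "\<And>n. n \<ge> 1 \<Longrightarrow> measure (bernoulli P)
    {\<omega>. deviates n (norm (cocycle M n \<omega> *v v2)) (ereal lyap) (\<epsilon> / 2)} \<le> C2 * exp (- c2 * real n)"
    using vector_large_deviations[OF v(2) half] by blast
  obtain D where D: "D > 0" "\<And>B. mnorm B \<le> D * max (norm (B *v v1)) (norm (B *v v2))"
    using mnorm_le_pair[OF v(3)] by blast
  define c where "c = min c1 c2"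
  define N where "N = nat \<lceil>2 / \<epsilon> * (\<bar>ln D\<bar> + \<bar>ln (norm v1)\<bar>)\<rceil> + 1"
  show ?thesis
  proof (intro exI conjI allI impI)
    show "c > 0" using 1 2 by (simp add: c_def)
    fix n assume n: "n \<ge> N"
    have n1: "n \<ge> 1" using n by (simp add: N_def)
    have "2 / \<epsilon> * (\<bar>ln D\<bar> + \<bar>ln (norm v1)\<bar>) \<le> real n" using n unfolding N_def by linarith
    then have n2: "\<bar>ln D\<bar> + \<bar>ln (norm v1)\<bar> \<le> real n * (\<epsilon> / 2)" using \<epsilon> by (simp add: field_simps)
    define E1 where "E1 = {\<omega>. deviates n (norm (cocycle M n \<omega> *v v1)) (ereal lyap) (\<epsilon> / 2)}"
    define E2 where "E2 = {\<omega>. deviates n (norm (cocycle M n \<omega> *v v2)) (ereal lyap) (\<epsilon> / 2)}"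
    have sub: "{\<omega>. deviates n (mnorm (cocycle M n \<omega>)) (ereal lyap) \<epsilon>} \<subseteq> E1 \<union> E2"
    proof (rule subsetI, rule ccontr)
      fix \<omega> assume \<omega>: "\<omega> \<in> {\<omega>. deviates n (mnorm (cocycle M n \<omega>)) (ereal lyap) \<epsilon>}" "\<omega> \<notin> E1 \<union> E2"
      define B where "B = cocycle M n \<omega>"
      define x1 x2 where "x1 = norm (B *v v1)" and "x2 = norm (B *v v2)"
      have x: "x1 > 0" "\<bar>ln x1 / real n - lyap\<bar> \<le> \<epsilon> / 2" "x2 > 0" "\<bar>ln x2 / real n - lyap\<bar> \<le> \<epsilon> / 2"
        using \<omega>(2) by (auto simp: E1_def E2_def deviates_def B_def x1_def x2_def not_le)
      have x': "ln x1 \<le> real n * (lyap + \<epsilon> / 2)" "real n * (lyap - \<epsilon> / 2) \<le> ln x1" "ln x2 \<le> real n * (lyap + \<epsilon> / 2)"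
        using x(2,4)[unfolded abs_divide_le_iff[OF n1]] by blast+
      have v1: "norm v1 > 0" using start_nz[OF v(1)] by simp
      have low: "x1 \<le> mnorm B * norm v1"
        unfolding x1_def by (rule norm_mult_mnorm)
      then have B: "mnorm B > 0" using x(1) v1 by (smt (verit) mult_nonpos_nonneg)
      have "ln x1 \<le> ln (mnorm B) + ln (norm v1)"
        using low x(1) B v1 by (simp flip: ln_mult_pos)
      moreover have "ln (mnorm B) \<le> ln D + max (ln x1) (ln x2)"
      proof -
        have "ln (mnorm B) \<le> ln (D * max x1 x2)"
          using D(2)[of B] B D(1) x by (simp add: x1_def x2_def)
        also have "\<dots> = ln D + ln (max x1 x2)" using D(1) x by (simp add: ln_mult_pos)
        also have "ln (max x1 x2) = max (ln x1) (ln x2)" using x by (simp add: max_def)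
        finally show ?thesis .
      qed
      moreover have "max (ln x1) (ln x2) \<le> real n * (lyap + \<epsilon> / 2)" using x' by simp
      ultimately have "ln (mnorm B) \<le> real n * (lyap + \<epsilon>)" "real n * (lyap - \<epsilon>) \<le> ln (mnorm B)"
        using x'(2) n2 by (auto simp: algebra_simps)
      then have "\<bar>ln (mnorm B) / real n - lyap\<bar> \<le> \<epsilon>" using n1 by (simp add: abs_divide_le_iff)
      then show False using \<omega>(1) B by (simp add: deviates_def B_def)
    qed
    have sets: "E1 \<in> sets (bernoulli P)" "E2 \<in> sets (bernoulli P)"
      unfolding E1_def E2_def cocycle_pre by (rule sets_pre)+
    have le: "exp (- c1 * real n) \<le> exp (- c * real n)" "exp (- c2 * real n) \<le> exp (- c * real n)"
      by (auto simp: c_def intro!: mult_right_mono)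
    have "measure (bernoulli P) {\<omega>. deviates n (mnorm (cocycle M n \<omega>)) (ereal lyap) \<epsilon>}
        \<le> measure (bernoulli P) (E1 \<union> E2)"
      using sets sub by (intro bern.finite_measure_mono) auto
    also have "\<dots> \<le> measure (bernoulli P) E1 + measure (bernoulli P) E2"
      using sets by (intro measure_Un_le)
    also have "\<dots> \<le> C1 * exp (- c1 * real n) + C2 * exp (- c2 * real n)"
      unfolding E1_def E2_def by (intro add_mono 1(2) 2(2) n1)
    also have "\<dots> \<le> \<bar>C1\<bar> * exp (- c * real n) + \<bar>C2\<bar> * exp (- c * real n)"
      using le by (intro add_mono mult_mono) auto
    finally show "measure (bernoulli P) {\<omega>. deviates n (mnorm (cocycle M n \<omega>)) (ereal lyap) \<epsilon>}
        \<le> (\<bar>C1\<bar> + \<bar>C2\<bar>) * exp (- c * real n)" by (simp add: algebra_simps)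
  qed
qed

text \<open>Exponential tails are summable, so Borel-Cantelli along
  \<open>\<epsilon> = 1 / (m + 1)\<close> gives convergence almost everywhere; uniqueness of limits
  then settles the definite description in \<open>L1\<close>.\<close>

lemma L1_eq_lyap:
  assumes v: "start v1" "start v2" "wedge v1 v2 \<noteq> 0"
  shows "L1 P M = ereal lyap"
proof -
  interpret bern: prob_space "bernoulli P" by (rule prob_space_bernoulli)
  let ?X = "\<lambda>\<omega> n. ereal (1 / real n) * elog (mnorm (cocycle M n \<omega>))"
  have ev: "AE \<omega> in bernoulli P. eventually (\<lambda>n. \<not> deviates n (mnorm (cocycle M n \<omega>)) (ereal lyap) \<epsilon>) sequentially"
    if \<epsilon>: "\<epsilon> > 0" for \<epsilon>
  proof -
    obtain C c N where c: "c > 0" "\<forall>n\<ge>N. measure (bernoulli P)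
      {\<omega>. deviates n (mnorm (cocycle M n \<omega>)) (ereal lyap) \<epsilon>} \<le> C * exp (- c * real n)"
      using norm_large_deviations[OF v \<epsilon>] by blast
    have "exp (- c * real n) = exp (- c) ^ n" for n
      by (metis exp_of_nat_mult mult.commute)
    then have "summable (\<lambda>n. C * exp (- c * real n))"
      using c(1) by (auto intro!: summable_mult summable_geometric)
    then have "summable (\<lambda>n. measure (bernoulli P) {\<omega>. deviates n (mnorm (cocycle M n \<omega>)) (ereal lyap) \<epsilon>})"
      by (rule summable_comparison_test'[where N = N]) (use c(2) in simp)
    then have "AE \<omega> in bernoulli P. eventually (\<lambda>n. \<omega> \<in> space (bernoulli P)
        - {\<omega>. deviates n (mnorm (cocycle M n \<omega>)) (ereal lyap) \<epsilon>}) sequentially"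
      by (intro borel_cantelli_AE1) (auto simp: cocycle_pre less_top[symmetric] intro: sets_pre)
    then show ?thesis by simp
  qed
  have conv: "AE \<omega> in bernoulli P. ?X \<omega> \<longlonglongrightarrow> ereal lyap"
  proof -
    have "AE \<omega> in bernoulli P. \<forall>m. eventually (\<lambda>n. \<not> deviates n (mnorm (cocycle M n \<omega>)) (ereal lyap) (1 / real (Suc m))) sequentially"
      by (subst AE_all_countable) (auto intro: ev)
    then show ?thesis
    proof eventually_elim
      fix \<omega> assume *: "\<forall>m. eventually (\<lambda>n. \<not> deviates n (mnorm (cocycle M n \<omega>)) (ereal lyap) (1 / real (Suc m))) sequentially"
      have pos: "eventually (\<lambda>n. mnorm (cocycle M n \<omega>) > 0) sequentially"
        using *[rule_format, of 0] by eventually_elim (simp add: deviates_def)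
      have "(\<lambda>n. ln (mnorm (cocycle M n \<omega>)) / real n) \<longlonglongrightarrow> lyap"
      proof (rule tendstoI)
        fix e :: real assume "e > 0"
        then obtain m where m: "1 / real (Suc m) < e"
          using reals_Archimedean[of e] by (auto simp: inverse_eq_divide)
        show "eventually (\<lambda>n. dist (ln (mnorm (cocycle M n \<omega>)) / real n) lyap < e) sequentially"
          using *[rule_format, of m]
        proof eventually_elim
          case (elim n)
          then have "\<bar>ln (mnorm (cocycle M n \<omega>)) / real n - lyap\<bar> \<le> 1 / real (Suc m)"
            by (simp add: deviates_def)
          with m show ?case by (simp add: dist_real_def)
        qed
      qed
      then have "(\<lambda>n. ereal (ln (mnorm (cocycle M n \<omega>)) / real n)) \<longlonglongrightarrow> ereal lyap" by simp
      then show "?X \<omega> \<longlonglongrightarrow> ereal lyap"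
        by (rule Lim_transform_eventually) (use pos in eventually_elim, simp add: elog_def)
    qed
  qed
  show ?thesis unfolding L1_def
  proof (rule the_equality)
    show "AE \<omega> in bernoulli P. ?X \<omega> \<longlonglongrightarrow> ereal lyap" by (rule conv)
    fix L assume "AE \<omega> in bernoulli P. ?X \<omega> \<longlonglongrightarrow> L"
    with conv have "AE \<omega> in bernoulli P. L = ereal lyap"
      by eventually_elim (rule LIMSEQ_unique)
    \<comment> \<open>A statement free of \<open>\<omega>\<close> that holds almost everywhere on a
      probability space is true.\<close>
    then show "L = ereal lyap" by simp
  qed
qed

end

section \<open>Winding of words in the parameter\<close>

text \<open>With \<open>y\<close> the derivative of \<open>x\<close>, the left side is the numerator
  in the derivative of \<open>wedge x u / (x \<bullet> u)\<close>; it has a sign when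
  \<open>x\<close> winds.\<close>

lemma wedge_inner_minor:
  "wedge y u * (x \<bullet> u) - wedge x u * (y \<bullet> u) = - (wedge x y * (norm u)\<^sup>2)"
  unfolding power2_norm_eq_inner
  by (simp add: wedge_def inner_vec_def sum_2 power2_eq_square algebra_simps)

lemma wedge_matrix: "wedge (B *v x) (B *v y) = det B * wedge x y"
  by (simp add: wedge_def det_2 matrix_vector_mult_def sum_2 algebra_simps)

lemma wedge_add_right: "wedge x (y + z) = wedge x y + wedge x z"
  by (simp add: wedge_def algebra_simps)

lemma wedge_eq_0_iff:
  assumes "y \<noteq> 0"
  shows "wedge x y = 0 \<longleftrightarrow> (\<exists>c. x = c *\<^sub>R y)"
proof
  assume "wedge x y = 0"
  then have eq: "x $ 1 * y $ 2 = x $ 2 * y $ 1" by (simp add: wedge_def)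
  consider "y $ 1 \<noteq> 0" | "y $ 2 \<noteq> 0" using assms by (auto simp: vec_eq_iff forall_2)
  then show "\<exists>c. x = c *\<^sub>R y"
  proof cases
    case 1
    then have "x = (x $ 1 / y $ 1) *\<^sub>R y" using eq by (simp add: vec_eq_iff forall_2 field_simps)
    then show ?thesis ..
  next
    case 2
    then have "x = (x $ 2 / y $ 2) *\<^sub>R y" using eq by (simp add: vec_eq_iff forall_2 field_simps)
    then show ?thesis ..
  qed
qed (auto simp: wedge_def)

text \<open>Every linear functional on the plane has the form \<open>wedge x k\<close>, so a
  rank-one map is such a functional times a vector spanning its range; the vector is
  \<open>rvec B\<close>, the representative from which \<open>eta\<close> is built.\<close>

lemma rank_one_decomposition:
  assumes "rank B = 1"
  shows "\<exists>k. k \<noteq> 0 \<and> rvec B \<noteq> 0 \<and> (\<forall>x. B *v x = wedge x k *\<^sub>R rvec B) \<and>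
    range_space B = range (\<lambda>c. c *\<^sub>R rvec B) \<and> kernel_space B = {x. wedge x k = 0}"
proof -
  have "B \<noteq> 0" using assms by auto
  then obtain x0 where "B *v x0 \<noteq> 0" by (metis matrix_eq matrix_vector_mult_0)
  then have "\<exists>v. v \<noteq> 0 \<and> v \<in> range_space B" by (auto simp: range_space_def)
  then have r: "rvec B \<noteq> 0" "rvec B \<in> range_space B"
    unfolding rvec_def using someI_ex[of "\<lambda>v. v \<noteq> 0 \<and> v \<in> range_space B"] by blast+
  have "dim (range_space B) \<le> card {rvec B}"
    using assms by (simp add: rank_dim_range range_space_def)
  then have sub: "range_space B \<subseteq> span {rvec B}"
    using r by (intro card_ge_dim_independent) (auto simp: independent_insert dependent_single)
  have "\<exists>c. B *v x = c *\<^sub>R rvec B" for x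
    using sub by (auto simp: range_space_def span_singleton)
  then obtain \<alpha> \<beta> where \<alpha>: "B *v axis 1 1 = \<alpha> *\<^sub>R rvec B" "B *v axis 2 1 = \<beta> *\<^sub>R rvec B"
    by blast
  \<comment> \<open>Read off from the images of the basis vectors, so that
    \<open>wedge x k = \<alpha> * x $ 1 + \<beta> * x $ 2\<close>.\<close>
  define k :: "real^2" where "k = vector [- \<beta>, \<alpha>]"
  have B: "B *v x = wedge x k *\<^sub>R rvec B" for x
  proof -
    have "x = x $ 1 *\<^sub>R axis 1 1 + x $ 2 *\<^sub>R axis 2 1"
      by (simp add: vec_eq_iff forall_2 axis_def)
    then have "B *v x = x $ 1 *\<^sub>R (B *v axis 1 1) + x $ 2 *\<^sub>R (B *v axis 2 1)"
      by (metis matrix_vector_mult_scaleR matrix_vector_right_distrib)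
    then show ?thesis unfolding \<alpha> by (simp add: wedge_def k_def algebra_simps)
  qed
  have k: "k \<noteq> 0" using B[of x0] \<open>B *v x0 \<noteq> 0\<close> by (auto simp: wedge_def)
  have "range_space B = range (\<lambda>c. c *\<^sub>R rvec B)"
  proof
    show "range_space B \<subseteq> range (\<lambda>c. c *\<^sub>R rvec B)" using sub by (simp add: span_singleton)
    obtain y where y: "rvec B = B *v y" using r(2) by (auto simp: range_space_def)
    have "c *\<^sub>R rvec B = B *v (c *\<^sub>R y)" for c by (simp add: matrix_vector_mult_scaleR y)
    then show "range (\<lambda>c. c *\<^sub>R rvec B) \<subseteq> range_space B" by (auto simp: range_space_def)
  qed
  moreover have "kernel_space B = {x. wedge x k = 0}" using B r by (simp add: kernel_space_def)
  ultimately show ?thesis using k r(1) B by blast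
qed

text \<open>Where \<open>wedge (x t) u\<close> is small, \<open>x t \<bullet> u\<close> is not, and there the quotient \<open>wedge (x t) u / (x t \<bullet> u)\<close>
  (the tangent of the angle) has derivative at most \<open>- c0\<close>.\<close>

lemma sublevel_measure:
  fixes x x' :: "real \<Rightarrow> real^2"
  assumes der: "\<And>t. t \<in> {a..a+1} \<Longrightarrow> (x has_vector_derivative x' t) (at t)"
    and turn: "\<And>t. t \<in> {a..a+1} \<Longrightarrow> wedge (x t) (x' t) \<ge> c0 * (norm (x t))\<^sup>2" and c0: "c0 > 0"
    and low: "\<And>t. t \<in> {a..a+1} \<Longrightarrow> m \<le> norm (x t)" and m: "m > 0"
    and lip: "\<And>s t. s \<in> {a..a+1} \<Longrightarrow> t \<in> {a..a+1} \<Longrightarrow> norm (x s - x t) \<le> L * \<bar>s - t\<bar>" and L: "L \<ge> 0"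
    and u: "u \<noteq> 0" and \<delta>: "0 \<le> \<delta>" "\<delta> \<le> m * norm u / 2"
  shows "closed {t \<in> {a..a+1}. \<bar>wedge (x t) u\<bar> \<le> \<delta>}"
    and "measure lborel {t \<in> {a..a+1}. \<bar>wedge (x t) u\<bar> \<le> \<delta>} \<le> (4 * L / m + 2) * (8 * \<delta> / (c0 * m * norm u))"
proof -
  define S where "S = {t \<in> {a..a+1}. \<bar>wedge (x t) u\<bar> \<le> \<delta>}"
  \<comment> \<open>On a piece of length \<open>1 / N\<close> the inner product
    \<open>x t \<bullet> u\<close> varies by at most \<open>m * norm u / 4\<close>. Adding 1 keeps
    \<open>N\<close> positive when \<open>L = 0\<close>.\<close>
  define N where "N = nat \<lceil>4 * L / m\<rceil> + 1"
  define d where "d = 4 * \<delta> / (c0 * m * norm u)"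
  have d: "d \<ge> 0" using \<delta> c0 m by (simp add: d_def)
  have "4 * L / m \<ge> 0" using L m by simp
  then have N: "4 * L / m \<le> real N" "real N \<le> 4 * L / m + 2" "N > 0"
    unfolding N_def by linarith+
  have nu: "norm u > 0" using u by simp
  have comp: "((\<lambda>t. x t $ i) has_real_derivative x' t $ i) (at t)" if "t \<in> {a..a+1}" for i t
    using bounded_linear.has_vector_derivative[OF bounded_linear_vec_nth der[OF that]]
    by (simp add: has_real_derivative_iff_has_vector_derivative)
  have cont: "continuous_on {a..a+1} x"
    using der by (meson continuous_at_imp_continuous_on has_vector_derivative_continuous)
  show closed: "closed {t \<in> {a..a+1}. \<bar>wedge (x t) u\<bar> \<le> \<delta>}"
    unfolding wedge_def by (intro continuous_on_closed_Collect_le continuous_intros cont)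
  have diam: "t - s \<le> d" if st: "s \<in> S" "t \<in> S" "s < t" "t - s \<le> 1 / real N" for s t
  proof -
    have sin: "s \<in> {a..a+1}" "\<bar>wedge (x s) u\<bar> \<le> \<delta>" and tin: "t \<in> {a..a+1}" "\<bar>wedge (x t) u\<bar> \<le> \<delta>"
      using st by (auto simp: S_def)
    \<comment> \<open>By Lagrange's identity a wedge of at most half of \<open>m * norm u\<close>
      leaves three quarters of its square to the inner product, more than the nine sixteenths
      claimed.\<close>
    have ip_s: "\<bar>x s \<bullet> u\<bar> \<ge> 3 / 4 * (m * norm u)"
    proof -
      have "(wedge (x s) u)\<^sup>2 \<le> (m * norm u / 2)\<^sup>2"
        using sin(2) \<delta> by (intro abs_le_square_iff[THEN iffD1]) auto
      moreover have "(m * norm u)\<^sup>2 \<le> (norm (x s) * norm u)\<^sup>2"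
        using low[OF sin(1)] m by (intro power_mono mult_right_mono) auto
      ultimately have "(x s \<bullet> u)\<^sup>2 \<ge> 3 / 4 * (m * norm u)\<^sup>2"
        using wedge_square_add_inner_square[of "x s" u] by (simp add: power_divide)
      moreover have "(3 / 4 * (m * norm u))\<^sup>2 \<le> 3 / 4 * (m * norm u)\<^sup>2"
        by (simp add: power_mult_distrib power_divide)
      ultimately have "(3 / 4 * (m * norm u))\<^sup>2 \<le> (x s \<bullet> u)\<^sup>2" by linarith
      then show ?thesis using m by (simp add: abs_le_square_iff[symmetric] abs_mult)
    qed
    have ip: "\<bar>x \<tau> \<bullet> u\<bar> \<ge> m * norm u / 2" if "\<tau> \<in> {s..t}" for \<tau>
    proof -
      have \<tau>: "\<tau> \<in> {a..a+1}" using that sin tin by auto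
      have "\<bar>x \<tau> \<bullet> u - x s \<bullet> u\<bar> \<le> norm (x \<tau> - x s) * norm u"
        unfolding inner_diff_left[symmetric] by (rule Cauchy_Schwarz_ineq2)
      also have "\<dots> \<le> L * (1 / real N) * norm u"
        using that st L by (intro mult_right_mono order_trans[OF lip[OF \<tau> sin(1)]] mult_left_mono) auto
      also have "\<dots> \<le> m / 4 * norm u"
        using N m by (intro mult_right_mono) (auto simp: field_simps)
      also have "\<dots> = 1 / 4 * (m * norm u)" by simp
      finally show ?thesis using ip_s by linarith
    qed
    have ip_nz: "x \<tau> \<bullet> u \<noteq> 0" if "\<tau> \<in> {s..t}" for \<tau>
      using ip[OF that] m nu by (smt (verit) divide_pos_pos mult_pos_pos)
    define g where "g = (\<lambda>\<tau>. wedge (x \<tau>) u / (x \<tau> \<bullet> u))"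
    define g' where "g' = (\<lambda>\<tau>. - (wedge (x \<tau>) (x' \<tau>) * (norm u)\<^sup>2 / (x \<tau> \<bullet> u)\<^sup>2))"
    have g: "(g has_real_derivative g' \<tau>) (at \<tau>)" if \<tau>: "\<tau> \<in> {s..t}" for \<tau>
    proof -
      have in_: "\<tau> \<in> {a..a+1}" using that sin tin by auto
      have "((\<lambda>t. wedge (x t) u) has_real_derivative wedge (x' \<tau>) u) (at \<tau>)"
        unfolding wedge_def by (auto intro!: derivative_eq_intros comp[OF in_])
      moreover have "((\<lambda>t. x t \<bullet> u) has_real_derivative x' \<tau> \<bullet> u) (at \<tau>)"
        unfolding inner_vec_def sum_2 inner_real_def by (auto intro!: derivative_eq_intros comp[OF in_])
      ultimately have "(g has_real_derivative (wedge (x' \<tau>) u * (x \<tau> \<bullet> u) - wedge (x \<tau>) u * (x' \<tau> \<bullet> u))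
          / ((x \<tau> \<bullet> u) * (x \<tau> \<bullet> u))) (at \<tau>)"
        unfolding g_def by (rule DERIV_divide) (rule ip_nz[OF \<tau>])
      then show ?thesis
        unfolding wedge_inner_minor g'_def by (simp add: power2_eq_square)
    qed
    obtain \<xi> where \<xi>: "s < \<xi>" "\<xi> < t" "g t - g s = (t - s) * g' \<xi>"
      using MVT2[OF st(3), of g g'] g by auto
    have "c0 \<le> - g' \<xi>"
    proof -
      have in_: "\<xi> \<in> {a..a+1}" "\<xi> \<in> {s..t}" using \<xi> sin tin by auto
      have "(x \<xi> \<bullet> u)\<^sup>2 \<le> (norm (x \<xi>) * norm u)\<^sup>2"
        using wedge_square_add_inner_square[of "x \<xi>" u] zero_le_power2[of "wedge (x \<xi>) u"] by linarith
      then have "c0 * (x \<xi> \<bullet> u)\<^sup>2 \<le> c0 * (norm (x \<xi>))\<^sup>2 * (norm u)\<^sup>2"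
        using c0 by (simp add: power_mult_distrib mult.assoc)
      also have "\<dots> \<le> wedge (x \<xi>) (x' \<xi>) * (norm u)\<^sup>2"
        by (intro mult_right_mono turn in_) auto
      finally show ?thesis using ip_nz[OF in_(2)] by (simp add: g'_def pos_le_divide_eq)
    qed
    then have "(t - s) * c0 \<le> (t - s) * (- g' \<xi>)"
      using st(3) by (intro mult_left_mono) auto
    also have "\<dots> = g s - g t" using \<xi>(3) by simp
    also have "\<dots> \<le> \<bar>g s\<bar> + \<bar>g t\<bar>" by simp
    also have "\<dots> \<le> \<delta> / (m * norm u / 2) + \<delta> / (m * norm u / 2)"
      unfolding g_def abs_divide using sin tin \<delta> m nu st
      by (intro add_mono frac_le ip) auto
    finally have "(t - s) * c0 \<le> 4 * \<delta> / (m * norm u)" by (simp add: field_simps)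
    then show ?thesis using c0 m nu by (simp add: d_def field_simps)
  qed
  have fm: "S \<inter> B \<in> fmeasurable lborel" if "closed B" for B
  proof (rule fmeasurableI2)
    show "{a..a+1} \<in> fmeasurable lborel" by (simp add: fmeasurable_def)
    show "S \<inter> B \<in> sets lborel" 
      using closed that unfolding S_def sets_lborel by (intro borel_closed closed_Int)
  qed (auto simp: S_def)
  define I where "I = (\<lambda>i. {a + real i / real N .. a + (real i + 1) / real N})"
  \<comment> \<open>One point of \<open>S\<close> in the piece has all the others within distance
    \<open>d\<close>, on either side; hence the factor 2.\<close>
  have piece: "measure lborel (S \<inter> I i) \<le> 2 * d" for i
  proof (cases "S \<inter> I i = {}")
    case False
    then obtain s where s: "s \<in> S" "s \<in> I i" by blast
    have "S \<inter> I i \<subseteq> {s - d..s + d}"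
    proof
      fix t assume t: "t \<in> S \<inter> I i"
      have "\<bar>t - s\<bar> \<le> (a + (real i + 1) / real N) - (a + real i / real N)"
        using t s by (auto simp: I_def abs_le_iff)
      also have "\<dots> = 1 / real N" by (simp add: add_divide_distrib)
      finally have ts: "\<bar>t - s\<bar> \<le> 1 / real N" .
      consider "s < t" | "t < s" | "s = t" by linarith
      then have "\<bar>t - s\<bar> \<le> d"
      proof cases
        case 1 then show ?thesis using diam[of s t] s t ts by auto
      next
        case 2 then show ?thesis using diam[of t s] s t ts by auto
      qed (use d in auto)
      then show "t \<in> {s - d..s + d}" by auto
    qed
    then have "measure lborel (S \<inter> I i) \<le> measure lborel {s - d..s + d}"
      using fm[of "I i"] d by (intro measure_mono_fmeasurable) (auto simp: I_def fmeasurable_def)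
    then show ?thesis using d by simp
  qed (use d in simp)
  have cover: "S \<subseteq> (\<Union>i<N. S \<inter> I i)"
  proof
    fix t assume t: "t \<in> S"
    then have t01: "0 \<le> t - a" "t - a \<le> 1" by (auto simp: S_def)
    show "t \<in> (\<Union>i<N. S \<inter> I i)"
    \<comment> \<open>At the right endpoint the floor would give \<open>N\<close>, one beyond the
      last piece.\<close>
    proof (cases "t - a = 1")
      case True
      then have "t \<in> I (N - 1)" using N(3) by (simp add: I_def of_nat_diff field_simps)
      then show ?thesis using t N(3) by auto
    next
      case False
      define i where "i = nat \<lfloor>(t - a) * real N\<rfloor>"
      have pos: "0 \<le> (t - a) * real N" using t01 by simp
      have "(t - a) * real N < 1 * real N" using False t01 N(3) by (intro mult_strict_right_mono) auto
      then have "i < N" "real i \<le> (t - a) * real N" "(t - a) * real N \<le> real i + 1"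
        unfolding i_def using pos by linarith+
      then have "t \<in> I i" "i < N" using N(3) by (auto simp: I_def field_simps)
      then show ?thesis using t by auto
    qed
  qed
  have fmI: "S \<inter> I i \<in> fmeasurable lborel" for i by (rule fm) (simp add: I_def)
  have "measure lborel S \<le> measure lborel (\<Union>i<N. S \<inter> I i)"
    using cover fm[of UNIV] by (intro measure_mono_fmeasurable fmeasurable.finite_UN) (auto intro: fmI fmeasurableD)
  also have "\<dots> \<le> (\<Sum>i<N. measure lborel (S \<inter> I i))"
    by (intro measure_UNION_le fmeasurableD fmI) auto
  also have "\<dots> \<le> (\<Sum>i<N. 2 * d)" by (intro sum_mono piece)
  also have "\<dots> = real N * (2 * d)" by simp
  also have "\<dots> \<le> (4 * L / m + 2) * (2 * d)" using N d by (intro mult_right_mono) auto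
  also have "2 * d = 8 * \<delta> / (c0 * m * norm u)" by (simp add: d_def)
  finally show "measure lborel {t \<in> {a..a+1}. \<bar>wedge (x t) u\<bar> \<le> \<delta>} \<le> (4 * L / m + 2) * (8 * \<delta> / (c0 * m * norm u))"
    by (simp add: S_def)
qed

section \<open>Winding carried from letters to words\<close>

lemma mat2_mult_expand:
  "B *v x = (B $ 1 $ 1 * x $ 1 + B $ 1 $ 2 * x $ 2) *\<^sub>R axis 1 1
    + (B $ 2 $ 1 * x $ 1 + B $ 2 $ 2 * x $ 2) *\<^sub>R axis 2 1"
  for B :: mat2
  by (simp add: vec_eq_iff forall_2 matrix_vector_mult_def sum_2 axis_def)

lemma has_vector_derivative_mat2_mult:
  fixes B :: "real \<Rightarrow> mat2"
  assumes B: "\<And>p q. ((\<lambda>s. B s $ p $ q) has_real_derivative B' $ p $ q) (at t)"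
    and y: "(y has_vector_derivative y') (at t)"
  shows "((\<lambda>s. B s *v y s) has_vector_derivative (B' *v y t + B t *v y')) (at t)"
proof -
  have comp: "((\<lambda>s. y s $ i) has_real_derivative y' $ i) (at t)" for i
    using bounded_linear.has_vector_derivative[OF bounded_linear_vec_nth y]
    by (simp add: has_real_derivative_iff_has_vector_derivative)
  have entry: "((\<lambda>s. B s $ p $ 1 * y s $ 1 + B s $ p $ 2 * y s $ 2) has_real_derivative
      (B' *v y t + B t *v y') $ p) (at t)" for p
    by (auto intro!: derivative_eq_intros B comp simp: matrix_vector_mult_def sum_2)
  have "((\<lambda>s. B s *v y s) has_vector_derivative
      (B' *v y t + B t *v y') $ 1 *\<^sub>R axis 1 1 + (B' *v y t + B t *v y') $ 2 *\<^sub>R axis 2 1) (at t)"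
    unfolding mat2_mult_expand[of "B _" "y _"]
    by (intro has_vector_derivative_add bounded_linear.has_vector_derivative[OF bounded_linear_scaleR_left]
      entry[unfolded has_real_derivative_iff_has_vector_derivative])
  moreover have "z $ 1 *\<^sub>R axis 1 1 + z $ 2 *\<^sub>R axis 2 1 = z" for z :: "real^2"
    by (simp add: vec_eq_iff forall_2 axis_def)
  ultimately show ?thesis by (simp only:)
qed

text \<open>A single constant governs growth, contraction and Lipschitz dependence of all letters;
  in the form \<open>exp D\<close> it becomes \<open>exp (D * n)\<close> along words. Clearing the
  denominator in \<open>winding\<close> admits \<open>v = 0\<close>.\<close>

locale winding_family =
  fixes A A' :: "real \<Rightarrow> nat \<Rightarrow> mat2" and Inv :: "nat set" and a c0 D :: real
  assumes finite_Inv: "finite Inv"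
    and deriv: "t \<in> {a..a+1} \<Longrightarrow> j \<in> Inv \<Longrightarrow>
      ((\<lambda>s. A s j $ p $ q) has_real_derivative A' t j $ p $ q) (at t)"
    and det_pos: "t \<in> {a..a+1} \<Longrightarrow> j \<in> Inv \<Longrightarrow> det (A t j) > 0"
    and c0: "c0 > 0"
    and winding: "t \<in> {a..a+1} \<Longrightarrow> j \<in> Inv \<Longrightarrow>
      wedge (A t j *v v) (A' t j *v v) \<ge> c0 * (norm (A t j *v v))\<^sup>2"
    and D_nonneg: "D \<ge> 0"
    and norm_le: "t \<in> {a..a+1} \<Longrightarrow> j \<in> Inv \<Longrightarrow> norm (A t j *v v) \<le> exp D * norm v"
    and norm_ge: "t \<in> {a..a+1} \<Longrightarrow> j \<in> Inv \<Longrightarrow> norm v \<le> exp D * norm (A t j *v v)"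
    and lipschitz: "s \<in> {a..a+1} \<Longrightarrow> t \<in> {a..a+1} \<Longrightarrow> j \<in> Inv \<Longrightarrow>
      norm (A s j *v v - A t j *v v) \<le> exp D * \<bar>s - t\<bar> * norm v"
begin

lemma word_snoc: "mprod (A t) (w @ [j]) *v v = A t j *v (mprod (A t) w *v v)"
  by (simp add: mprod_append_vec)

lemma word_norm_le:
  "t \<in> {a..a+1} \<Longrightarrow> set w \<subseteq> Inv \<Longrightarrow> norm (mprod (A t) w *v v) \<le> exp (D * real (length w)) * norm v"
proof (induction w rule: rev_induct)
  case (snoc j w)
  have "norm (mprod (A t) (w @ [j]) *v v) \<le> exp D * norm (mprod (A t) w *v v)"
    unfolding word_snoc using snoc.prems by (intro norm_le) auto
  also have "\<dots> \<le> exp D * (exp (D * real (length w)) * norm v)"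
    using snoc by (intro mult_left_mono) auto
  finally show ?case by (simp add: algebra_simps exp_add)
qed simp

lemma word_norm_ge:
  "t \<in> {a..a+1} \<Longrightarrow> set w \<subseteq> Inv \<Longrightarrow> norm v \<le> exp (D * real (length w)) * norm (mprod (A t) w *v v)"
proof (induction w rule: rev_induct)
  case (snoc j w)
  have "norm v \<le> exp (D * real (length w)) * norm (mprod (A t) w *v v)" using snoc by simp
  also have "\<dots> \<le> exp (D * real (length w)) * (exp D * norm (mprod (A t) (w @ [j]) *v v))"
    unfolding word_snoc using snoc.prems by (intro mult_left_mono norm_ge) auto
  finally show ?case by (simp add: algebra_simps exp_add)
qed simp

text \<open>Telescoping: the letters are exchanged one at a time, which costs the factor
  \<open>length w\<close>.\<close>

lemma word_lipschitz:
  "s \<in> {a..a+1} \<Longrightarrow> t \<in> {a..a+1} \<Longrightarrow> set w \<subseteq> Inv \<Longrightarrow>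
    norm (mprod (A s) w *v v - mprod (A t) w *v v)
      \<le> real (length w) * exp (D * real (length w)) * norm v * \<bar>s - t\<bar>"
proof (induction w rule: rev_induct)
  case (snoc j w)
  let ?x = "\<lambda>t. mprod (A t) w *v v" and ?e = "exp (D * real (length w))"
  have "mprod (A s) (w @ [j]) *v v - mprod (A t) (w @ [j]) *v v
      = A s j *v (?x s - ?x t) + (A s j *v ?x t - A t j *v ?x t)"
    unfolding word_snoc by (simp add: matrix_vector_mult_diff_distrib)
  also have "norm \<dots> \<le> exp D * norm (?x s - ?x t) + exp D * \<bar>s - t\<bar> * norm (?x t)"
    using snoc.prems by (intro order_trans[OF norm_triangle_ineq] add_mono norm_le lipschitz) auto
  also have "\<dots> \<le> exp D * (real (length w) * ?e * norm v * \<bar>s - t\<bar>) + exp D * \<bar>s - t\<bar> * (?e * norm v)"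
    using snoc by (intro add_mono mult_left_mono word_norm_le) auto
  finally show ?case by (simp add: algebra_simps exp_add)
qed simp

text \<open>After appending \<open>j\<close> the derivative is \<open>A' x + A x'\<close>. The first
  term winds at rate \<open>c0\<close>; the second contributes \<open>det A * wedge x x'\<close>,
  nonnegative by induction. The empty word is constant in \<open>t\<close>, hence the case
  distinction.\<close>

lemma word_deriv:
  "set w \<subseteq> Inv \<Longrightarrow> \<exists>x'. \<forall>t\<in>{a..a+1}. ((\<lambda>s. mprod (A s) w *v v) has_vector_derivative x' t) (at t) \<and>
    wedge (mprod (A t) w *v v) (x' t) \<ge> (if w = [] then 0 else c0 * (norm (mprod (A t) w *v v))\<^sup>2)"
proof (induction w rule: rev_induct)
  case Nil
  show ?case by (rule exI[of _ "\<lambda>_. 0"]) (auto simp: wedge_def)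
next
  case (snoc j w)
  let ?x = "\<lambda>t. mprod (A t) w *v v"
  obtain x' where "\<forall>t\<in>{a..a+1}. (?x has_vector_derivative x' t) (at t) \<and>
      wedge (?x t) (x' t) \<ge> (if w = [] then 0 else c0 * (norm (?x t))\<^sup>2)"
    using snoc.IH snoc.prems by auto
  then have x': "\<And>t. t \<in> {a..a+1} \<Longrightarrow> (?x has_vector_derivative x' t) (at t)"
    "\<And>t. t \<in> {a..a+1} \<Longrightarrow> wedge (?x t) (x' t) \<ge> (if w = [] then 0 else c0 * (norm (?x t))\<^sup>2)"
    by blast+
  show ?case
  proof (intro exI ballI conjI)
    fix t assume t: "t \<in> {a..a+1}"
    have j: "j \<in> Inv" using snoc.prems by simp
    have "((\<lambda>s. A s j *v ?x s) has_vector_derivative (A' t j *v ?x t + A t j *v x' t)) (at t)"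
      by (rule has_vector_derivative_mat2_mult deriv t j x'(1))+
    then show "((\<lambda>s. mprod (A s) (w @ [j]) *v v) has_vector_derivative
        (A' t j *v ?x t + A t j *v x' t)) (at t)"
      by (simp only: word_snoc)
    have "wedge (?x t) (x' t) \<ge> 0"
      using x'(2)[OF t] c0 by (auto split: if_splits intro: order_trans[rotated])
    then have "det (A t j) * wedge (?x t) (x' t) \<ge> 0" using det_pos[OF t j] by simp
    with winding[OF t j, of "?x t"]
    show "wedge (mprod (A t) (w @ [j]) *v v) (A' t j *v ?x t + A t j *v x' t)
      \<ge> (if w @ [j] = [] then 0 else c0 * (norm (mprod (A t) (w @ [j]) *v v))\<^sup>2)"
      by (simp add: word_snoc wedge_add_right wedge_matrix)
  qed
qed

definition resonant :: "nat list \<Rightarrow> real^2 \<Rightarrow> real^2 \<Rightarrow> real \<Rightarrow> real set" where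
  "resonant w v u \<delta> = {t \<in> {a..a+1}. \<bar>wedge (mprod (A t) w *v v) u\<bar> \<le> \<delta>}"

text \<open>An instance of \<open>sublevel_measure\<close> with \<open>m = norm v / e\<close> and
  \<open>L = n * e * norm v\<close>, where \<open>e = exp (D * n)\<close>. The number of pieces
  costs \<open>e\<^sup>2\<close> and the lower bound on the norm another \<open>e\<close>, whence
  \<open>3 * D\<close>.\<close>

lemma resonant_measure:
  assumes w: "w \<in> words Inv n" "n \<ge> 1" and vu: "v \<noteq> 0" "u \<noteq> 0"
    and \<delta>: "0 \<le> \<delta>" "\<delta> \<le> exp (- D * real n) * norm v * norm u / 2"
  shows "closed (resonant w v u \<delta>)"
    and "measure lborel (resonant w v u \<delta>) \<le> 48 * real n * exp (3 * D * real n) / (c0 * norm v * norm u) * \<delta>"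
proof -
  have w': "set w \<subseteq> Inv" "length w = n" "w \<noteq> []" using w by (auto simp: words_def)
  obtain x' where "\<forall>t\<in>{a..a+1}. ((\<lambda>s. mprod (A s) w *v v) has_vector_derivative x' t) (at t) \<and>
      wedge (mprod (A t) w *v v) (x' t) \<ge> c0 * (norm (mprod (A t) w *v v))\<^sup>2"
    using word_deriv[OF w'(1), of v] w'(3) by auto
  then have x': "\<And>t. t \<in> {a..a+1} \<Longrightarrow> ((\<lambda>s. mprod (A s) w *v v) has_vector_derivative x' t) (at t)"
    "\<And>t. t \<in> {a..a+1} \<Longrightarrow> wedge (mprod (A t) w *v v) (x' t) \<ge> c0 * (norm (mprod (A t) w *v v))\<^sup>2"
    by blast+
  define e where "e = exp (D * real n)"
  have e: "e \<ge> 1" using D_nonneg by (simp add: e_def)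
  have exp_e: "exp (- D * real n) = 1 / e" "exp (3 * D * real n) = e * e * e"
    by (simp_all add: e_def exp_minus field_simps flip: exp_add)
  have nv: "norm v > 0" "norm u > 0" using vu by auto
  have low: "norm v / e \<le> norm (mprod (A t) w *v v)" if "t \<in> {a..a+1}" for t
    using word_norm_ge[OF that w'(1), of v] e by (simp add: w'(2) e_def[symmetric] field_simps)
  have lip: "norm (mprod (A s) w *v v - mprod (A t) w *v v) \<le> real n * e * norm v * \<bar>s - t\<bar>"
    if "s \<in> {a..a+1}" "t \<in> {a..a+1}" for s t
    using word_lipschitz[OF that w'(1), of v] by (simp add: w'(2) e_def)
  have \<delta>': "\<delta> \<le> norm v / e * norm u / 2" using \<delta>(2) unfolding exp_e by (simp add: mult_ac)
  have m: "norm v / e > 0" "real n * e * norm v \<ge> 0" using nv e by auto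
  note sub = sublevel_measure[where a = a, OF x' c0 low m(1) lip m(2) vu(2) \<delta>(1) \<delta>']
  show "closed (resonant w v u \<delta>)" unfolding resonant_def by (rule sub(1))
  have "4 * (real n * e * norm v) / (norm v / e) + 2 = 4 * real n * e * e + 2"
    using nv e by (simp add: field_simps)
  also have "\<dots> \<le> 6 * real n * (e * e)"
  proof -
    have "1 * 1 \<le> real n * (e * e)" using w(2) e mult_mono[OF e e] by (intro mult_mono) auto
    then show ?thesis by (simp add: mult_ac)
  qed
  finally have "(4 * (real n * e * norm v) / (norm v / e) + 2) * (8 * \<delta> / (c0 * (norm v / e) * norm u))
      \<le> 6 * real n * (e * e) * (8 * \<delta> / (c0 * (norm v / e) * norm u))"
    using \<delta>(1) c0 nv e by (intro mult_right_mono) auto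
  also have "\<dots> = 48 * real n * exp (3 * D * real n) / (c0 * norm v * norm u) * \<delta>"
    unfolding exp_e(2) using e nv c0 by (simp add: field_simps)
  finally show "measure lborel (resonant w v u \<delta>)
      \<le> 48 * real n * exp (3 * D * real n) / (c0 * norm v * norm u) * \<delta>"
    unfolding resonant_def using sub(2) by (rule order_trans[rotated])
qed

lemma resonant_fmeasurable:
  assumes "w \<in> words Inv n" "n \<ge> 1" "v \<noteq> 0" "u \<noteq> 0"
    "0 \<le> \<delta>" "\<delta> \<le> exp (- D * real n) * norm v * norm u / 2"
  shows "resonant w v u \<delta> \<in> fmeasurable lborel"
proof (rule fmeasurableI2)
  show "{a..a+1} \<in> fmeasurable lborel" by (simp add: fmeasurable_def)
  show "resonant w v u \<delta> \<in> sets lborel"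
    using resonant_measure(1)[OF assms] by (simp add: borel_closed)
qed (auto simp: resonant_def)

text \<open>The case \<open>\<delta> = 0\<close> of the measure estimate.\<close>

lemma AE_nonresonant:
  assumes w: "w \<in> words Inv n" "n \<ge> 1" and vu: "v \<noteq> 0" "u \<noteq> 0"
  shows "AE t in lborel. t \<in> {a..a+1} \<longrightarrow> wedge (mprod (A t) w *v v) u \<noteq> 0"
proof -
  define E where "E = resonant w v u 0"
  define C where "C = 48 * real n * exp (3 * D * real n) / (c0 * norm v * norm u)"
  have E: "E \<in> fmeasurable lborel"
    unfolding E_def using vu by (intro resonant_fmeasurable[OF w vu]) auto
  have "measure lborel E \<le> 0"
    using resonant_measure(2)[OF w vu, of 0] by (simp add: E_def)
  then have "measure lborel E = 0" by (simp add: order_antisym)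
  then have "E \<in> null_sets lborel" using fmeasurableD[OF E] emeasure_eq_measure2[OF E] by (intro null_setsI) simp_all
  from AE_not_in[OF this] show ?thesis by eventually_elim (auto simp: E_def resonant_def)
qed

text \<open>The exponent is the same for all \<open>v\<close> and \<open>u\<close>; only
  \<open>n0\<close> depends on them. In it \<open>3 * D\<close> cancels the measure estimate, the
  logarithm cancels the number of words, and 2 leaves the summable
  \<open>n * exp (- 2 * n)\<close>.\<close>

lemma AE_wedge_lower_bound:
  assumes vu: "v \<noteq> 0" "u \<noteq> 0"
  shows "AE t in lborel. t \<in> {a..a+1} \<longrightarrow> (\<exists>n0. \<forall>n\<ge>n0. \<forall>w\<in>words Inv n.
    exp (- (3 * D + 2 + ln (real (card Inv) + 1)) * real n) \<le> \<bar>wedge (mprod (A t) w *v v) u\<bar>)"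
proof -
  define K where "K = 3 * D + 2 + ln (real (card Inv) + 1)"
  define \<mu> where "\<mu> = norm v * norm u"
  have \<mu>: "\<mu> > 0" using vu by (simp add: \<mu>_def)
  define E where "E = (\<lambda>n. \<Union>w\<in>words Inv n. resonant w v u (exp (- K * real n)))"
  \<comment> \<open>From \<open>n1\<close> on, \<open>exp (- K * n)\<close> meets the smallness
    hypothesis of \<open>resonant_measure\<close>, and words are nonempty.\<close>
  define n1 where "n1 = nat \<lceil>- ln (\<mu> / 2)\<rceil> + 1"
  have n1: "exp (- K * real n) \<le> exp (- D * real n) * norm v * norm u / 2" if "n \<ge> n1" for n
  proof -
    have "- real n \<le> ln (\<mu> / 2)" using that unfolding n1_def by linarith
    moreover have "K * real n \<ge> (D + 1) * real n"
      using D_nonneg by (intro mult_right_mono) (auto simp: K_def add_nonneg_nonneg)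
    ultimately have "- K * real n \<le> - D * real n + ln (\<mu> / 2)" by (simp add: algebra_simps)
    then have "exp (- K * real n) \<le> exp (- D * real n + ln (\<mu> / 2))" by (simp only: exp_le_cancel_iff)
    also have "\<dots> = exp (- D * real n) * exp (ln (\<mu> / 2))" by (rule exp_add)
    also have "exp (ln (\<mu> / 2)) = \<mu> / 2" using \<mu> by simp
    finally show ?thesis by (simp add: \<mu>_def algebra_simps)
  qed
  have fm: "resonant w v u (exp (- K * real n)) \<in> fmeasurable lborel" if "n \<ge> n1" "w \<in> words Inv n" for n w
    using that n1[of n] by (intro resonant_fmeasurable[OF that(2) _ vu]) (auto simp: n1_def)
  have fmE: "E n \<in> fmeasurable lborel" if "n \<ge> n1" for n
    unfolding E_def using that by (intro fmeasurable.finite_UN finite_words finite_Inv fm)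
  have mE: "measure lborel (E n) \<le> 48 / (c0 * \<mu>) * exp (- 1) ^ n" if n: "n \<ge> n1" for n
  proof -
    define k where "k = real (card Inv) + 1"
    have k: "k > 0" by (simp add: k_def)
    have "measure lborel (E n) \<le> (\<Sum>w\<in>words Inv n. measure lborel (resonant w v u (exp (- K * real n))))"
      unfolding E_def by (intro measure_UNION_le finite_words finite_Inv fmeasurableD fm n)
    also have "\<dots> \<le> (\<Sum>w\<in>words Inv n. 48 * real n * exp (3 * D * real n) / (c0 * norm v * norm u) * exp (- K * real n))"
      using n n1[OF n] by (intro sum_mono resonant_measure(2) vu) (auto simp: n1_def)
    also have "\<dots> = real (card Inv) ^ n * (48 * real n * exp (3 * D * real n) / (c0 * \<mu>) * exp (- K * real n))"
      using card_lists_length_eq[OF finite_Inv, of n] by (simp add: words_def \<mu>_def mult.assoc)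
    also have "\<dots> \<le> k ^ n * (48 * real n * exp (3 * D * real n) / (c0 * \<mu>) * exp (- K * real n))"
      using c0 \<mu> by (intro mult_right_mono power_mono) (auto simp: k_def)
    also have "\<dots> = 48 / (c0 * \<mu>) * (real n * (k ^ n * exp (3 * D * real n) * exp (- K * real n)))"
      by simp
    also have "k ^ n = exp (ln k * real n)" using k by (metis exp_ln exp_of_nat2_mult)
    also have "exp (ln k * real n) * exp (3 * D * real n) * exp (- K * real n) = exp (- 2 * real n)"
      unfolding exp_add[symmetric] by (simp add: K_def k_def algebra_simps)
    also have "real n * exp (- 2 * real n) \<le> exp (real n) * exp (- 2 * real n)"
    proof (rule mult_right_mono)
      show "real n \<le> exp (real n)" using exp_ge_add_one_self[of "real n"] by linarith
    qed simp
    also have "\<dots> = exp (- 1) ^ n" by (simp flip: exp_add exp_of_nat_mult)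
    finally show ?thesis using c0 \<mu> by (simp add: divide_right_mono)
  qed
  have "summable (\<lambda>n. 48 / (c0 * \<mu>) * exp (- 1) ^ (n + n1))"
    by (intro summable_mult summable_ignore_initial_segment summable_geometric) simp
  moreover have "norm (measure lborel (E (n + n1))) \<le> 48 / (c0 * \<mu>) * exp (- 1) ^ (n + n1)" for n
    using mE[of "n + n1"] by simp
  ultimately have sum: "summable (\<lambda>n. measure lborel (E (n + n1)))"
    by (rule summable_comparison_test')
  have "AE t in lborel. eventually (\<lambda>n. t \<in> space lborel - E (n + n1)) sequentially"
    using fmE by (intro borel_cantelli_AE1 sum) (auto simp: fmeasurable_def)
  then show ?thesis
  proof eventually_elim
    case (elim t)
    then obtain n2 where n2: "\<And>n. n \<ge> n2 \<Longrightarrow> t \<notin> E (n + n1)" by (auto simp: eventually_sequentially)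
    have "t \<notin> E n" if "n \<ge> n1 + n2" for n using n2[of "n - n1"] that by simp
    then show ?case
      unfolding E_def resonant_def K_def[symmetric] by (auto intro!: exI[of _ "n1 + n2"] less_imp_le simp: not_le)
  qed
qed

end

section \<open>Almost every parameter\<close>

lemma smooth_onD:
  assumes "smooth_on S f"
  shows "t \<in> S \<Longrightarrow> (f has_real_derivative deriv f t) (at t)" and "continuous_on S (deriv f)"
proof -
  obtain U where U: "S \<subseteq> U" "\<And>m x. x \<in> U \<Longrightarrow> ((deriv ^^ m) f) field_differentiable (at x)"
    using assms by (auto simp: smooth_on_def)
  show "(f has_real_derivative deriv f t) (at t)" if "t \<in> S"
    using U(2)[of t 0] U(1) that by (auto simp: DERIV_deriv_iff_field_differentiable)
  show "continuous_on S (deriv f)"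
    using U(1) U(2)[of _ 1]
    by (auto intro!: continuous_at_imp_continuous_on field_differentiable_imp_continuous_at)
qed

text \<open>Bounds the operator norm, and its continuity in the parameter can be read off the
  entries, so that compactness applies.\<close>

definition entry_sum :: "mat2 \<Rightarrow> real" where
  "entry_sum B = (\<Sum>p\<in>UNIV. \<Sum>q\<in>UNIV. \<bar>B $ p $ q\<bar>)"

lemma norm_mult_entry_sum: "norm (B *v x) \<le> entry_sum B * norm x"
  unfolding entry_sum_def
  by (rule order_trans[OF norm_mult_mnorm mult_right_mono])
    (auto simp: mnorm_def onorm_le_matrix_component_sum)

lemma entry_sum_nonneg: "entry_sum B \<ge> 0"
  unfolding entry_sum_def by (intro sum_nonneg) auto

lemma entry_le_entry_sum: "\<bar>B $ p $ q\<bar> \<le> entry_sum B"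
proof -
  have "\<bar>B $ p $ q\<bar> \<le> (\<Sum>q\<in>UNIV. \<bar>B $ p $ q\<bar>)" by (rule member_le_sum) auto
  also have "\<dots> \<le> entry_sum B" unfolding entry_sum_def by (rule member_le_sum) (auto intro: sum_nonneg)
  finally show ?thesis .
qed

text \<open>The adjugate inverts \<open>B\<close> up to the determinant and has the same entries up
  to order and sign.\<close>

lemma det_norm_le: "\<bar>det B\<bar> * norm x \<le> entry_sum B * norm (B *v x)"
proof -
  define C :: mat2 where "C = vector [vector [B $ 2 $ 2, - (B $ 1 $ 2)], vector [- (B $ 2 $ 1), B $ 1 $ 1]]"
  have "C *v (B *v x) = det B *\<^sub>R x"
    by (simp add: C_def vec_eq_iff forall_2 matrix_vector_mult_def sum_2 det_2 algebra_simps)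
  then have "\<bar>det B\<bar> * norm x = norm (C *v (B *v x))" by simp
  also have "\<dots> \<le> entry_sum C * norm (B *v x)" by (rule norm_mult_entry_sum)
  also have "entry_sum C = entry_sum B" by (simp add: entry_sum_def sum_2 C_def)
  finally show ?thesis .
qed

text \<open>All quantities to be bounded are summands of one continuous function \<open>F\<close> on
  a compact interval.\<close>

lemma winding_familyI:
  fixes A :: "real \<Rightarrow> nat \<Rightarrow> mat2" and a c0 :: real
  assumes fin: "finite Inv"
    and smooth: "\<And>j. j \<in> Inv \<Longrightarrow> smooth_mat_family {a..a+1} (\<lambda>t. A t j)"
    and det: "\<And>t j. t \<in> {a..a+1} \<Longrightarrow> j \<in> Inv \<Longrightarrow> det (A t j) > 0"
    and c0: "c0 > 0"
    and wind: "\<And>t j v. t \<in> {a..a+1} \<Longrightarrow> j \<in> Inv \<Longrightarrow> v \<noteq> 0 \<Longrightarrow>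
      wedge (A t j *v v) (vector_derivative (\<lambda>s. A s j *v v) (at t)) / (norm (A t j *v v))\<^sup>2 \<ge> c0"
  shows "\<exists>A' D. winding_family A A' Inv a c0 D"
proof -
  define A' :: "real \<Rightarrow> nat \<Rightarrow> mat2" where "A' = (\<lambda>t j. \<chi> p q. deriv (\<lambda>s. A s j $ p $ q) t)"
  have smooth_entry: "smooth_on {a..a+1} (\<lambda>t. A t j $ p $ q)" if "j \<in> Inv" for j p q
    using smooth[OF that] by (simp add: smooth_mat_family_def)
  have deriv: "((\<lambda>s. A s j $ p $ q) has_real_derivative A' t j $ p $ q) (at t)"
    if "t \<in> {a..a+1}" "j \<in> Inv" for t j p q
    using smooth_onD(1)[OF smooth_entry[OF that(2)] that(1)] by (simp add: A'_def)
  have cont: "continuous_on {a..a+1} (\<lambda>t. A t j $ p $ q)" if "j \<in> Inv" for j p q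
    by (intro continuous_at_imp_continuous_on ballI DERIV_isCont[OF deriv] that)
  have cont': "continuous_on {a..a+1} (\<lambda>t. A' t j $ p $ q)" if "j \<in> Inv" for j p q
    using smooth_onD(2)[OF smooth_entry[OF that]] by (simp add: A'_def)
  define F where "F = (\<lambda>t. \<Sum>j\<in>Inv. entry_sum (A t j) + entry_sum (A' t j) + entry_sum (A t j) / det (A t j))"
  have cont_sum: "continuous_on {a..a+1} (\<lambda>t. entry_sum (A t j))" "continuous_on {a..a+1} (\<lambda>t. entry_sum (A' t j))"
      "continuous_on {a..a+1} (\<lambda>t. det (A t j))" if "j \<in> Inv" for j
    unfolding entry_sum_def det_2 by (intro continuous_intros cont cont' that)+
  have det_nz: "\<forall>t\<in>{a..a+1}. det (A t j) \<noteq> 0" if "j \<in> Inv" for j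
    using det[OF _ that] by (metis less_irrefl)
  have "continuous_on {a..a+1} F"
    unfolding F_def
    by (rule continuous_on_sum) (intro continuous_on_add continuous_on_divide cont_sum det_nz)
  then have "compact (F ` {a..a+1})" by (intro compact_continuous_image) auto
  then have "bdd_above (F ` {a..a+1})" by (intro bounded_imp_bdd_above compact_imp_bounded)
  then obtain b where b: "\<And>t. t \<in> {a..a+1} \<Longrightarrow> F t \<le> b"
    unfolding bdd_above_def by blast
  \<comment> \<open>The factor 4 counts the entries, each Lipschitz with constant \<open>b\<close>;
    the maximum with 1 gives \<open>D \<ge> 0\<close>.\<close>
  define D where "D = ln (max 1 (4 * b))"
  have D: "exp D = max 1 (4 * b)" "D \<ge> 0" by (simp_all add: D_def)
  have part: "entry_sum (A t j) \<le> b \<and> entry_sum (A' t j) \<le> b \<and> entry_sum (A t j) / det (A t j) \<le> b"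
    if "t \<in> {a..a+1}" "j \<in> Inv" for t j
  proof -
    have nn: "entry_sum (A t i) / det (A t i) \<ge> 0" if "i \<in> Inv" for i
      using entry_sum_nonneg[of "A t i"] det[OF \<open>t \<in> _\<close> that] by simp
    have "entry_sum (A t j) + entry_sum (A' t j) + entry_sum (A t j) / det (A t j) \<le> F t"
      unfolding F_def using that fin nn by (intro member_le_sum) (auto intro!: add_nonneg_nonneg entry_sum_nonneg)
    then show ?thesis
      using b[OF that(1)] nn[OF that(2)] entry_sum_nonneg[of "A t j"] entry_sum_nonneg[of "A' t j"] by linarith
  qed
  have b_le: "b \<le> exp D" "4 * b \<le> exp D" using D(1) by linarith+
  show ?thesis
  proof (intro exI winding_family.intro)
    fix t j and v :: "real^2" assume t: "t \<in> {a..a+1}" and j: "j \<in> Inv"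
    show "wedge (A t j *v v) (A' t j *v v) \<ge> c0 * (norm (A t j *v v))\<^sup>2"
    proof (cases "v = 0")
      case False
      have "((\<lambda>s. A s j *v v) has_vector_derivative A' t j *v v) (at t)"
        using has_vector_derivative_mat2_mult[of "\<lambda>s. A s j" "A' t j" t "\<lambda>_. v" 0] deriv[OF t j] by simp
      then have "vector_derivative (\<lambda>s. A s j *v v) (at t) = A' t j *v v" by (rule vector_derivative_at)
      moreover have "A t j *v v \<noteq> 0"
        using det_norm_le[of "A t j" v] det[OF t j] False by (auto simp: mult_le_0_iff)
      ultimately show ?thesis using wind[OF t j False] by (simp add: pos_le_divide_eq)
    qed (simp add: wedge_def)
    show "norm (A t j *v v) \<le> exp D * norm v"
      using part[OF t j] b_le by (intro order_trans[OF norm_mult_entry_sum] mult_right_mono) auto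
    have "norm v \<le> entry_sum (A t j) / det (A t j) * norm (A t j *v v)"
      using det_norm_le[of "A t j" v] det[OF t j] by (simp add: field_simps)
    also have "\<dots> \<le> exp D * norm (A t j *v v)"
      using part[OF t j] b_le by (intro mult_right_mono) auto
    finally show "norm v \<le> exp D * norm (A t j *v v)" .
    fix s assume s: "s \<in> {a..a+1}"
    have entry: "\<bar>(A s j - A t j) $ p $ q\<bar> \<le> b * \<bar>s - t\<bar>" for p q
    proof -
      have "norm (A s j $ p $ q - A t j $ p $ q) \<le> b * norm (s - t)"
      proof (rule field_differentiable_bound[where S = "{a..a+1}" and f' = "\<lambda>t. A' t j $ p $ q"])
        fix z assume z: "z \<in> {a..a+1}"
        show "((\<lambda>t. A t j $ p $ q) has_field_derivative A' z j $ p $ q) (at z within {a..a+1})"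
          using deriv[OF z j] by (rule has_field_derivative_at_within)
        show "norm (A' z j $ p $ q) \<le> b"
          using part[OF z j] entry_le_entry_sum[of "A' z j" p q] by simp
      qed (use s t in auto)
      then show ?thesis by simp
    qed
    have "norm (A s j *v v - A t j *v v) = norm ((A s j - A t j) *v v)"
      by (simp add: matrix_vector_mult_diff_rdistrib)
    also have "\<dots> \<le> entry_sum (A s j - A t j) * norm v" by (rule norm_mult_entry_sum)
    also have "\<dots> \<le> (\<Sum>p\<in>(UNIV :: 2 set). \<Sum>q\<in>(UNIV :: 2 set). b * \<bar>s - t\<bar>) * norm v"
      unfolding entry_sum_def by (intro mult_right_mono sum_mono entry) auto
    also have "\<dots> = (4 * b) * \<bar>s - t\<bar> * norm v" by simp
    also have "\<dots> \<le> exp D * \<bar>s - t\<bar> * norm v" using b_le by (intro mult_right_mono) auto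
    finally show "norm (A s j *v v - A t j *v v) \<le> exp D * \<bar>s - t\<bar> * norm v" .
  qed (use fin c0 D deriv det in auto)
qed

text \<open>For each pair of singular letters the lower bound holds only beyond some length;
  finitely many shorter words remain, and enlarging the constant takes care of them.\<close>

lemma (in winding_family) renewal_cocycleI:
  assumes t: "t \<in> {a..a+1}"
    and alph: "finite Sing" "Sing \<inter> Inv = {}" "Sing \<noteq> {}" "Inv \<noteq> {}" "set_pmf P = Sing \<union> Inv"
    and sing: "\<And>s x. s \<in> Sing \<Longrightarrow> A t s *v x = wedge x (\<kappa> s) *\<^sub>R r s"
    and nz: "\<And>s s' w. s \<in> Sing \<Longrightarrow> s' \<in> Sing \<Longrightarrow> set w \<subseteq> Inv \<Longrightarrow> wedge (mprod (A t) w *v r s) (\<kappa> s') \<noteq> 0"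
    and lower: "\<And>s s'. s \<in> Sing \<Longrightarrow> s' \<in> Sing \<Longrightarrow> \<exists>n0. \<forall>n\<ge>n0. \<forall>w\<in>words Inv n.
      exp (- K * real n) \<le> \<bar>wedge (mprod (A t) w *v r s) (\<kappa> s')\<bar>"
  shows "\<exists>K'. renewal_cocycle P Sing Inv (A t) r \<kappa> K'"
proof -
  let ?f = "\<lambda>s s' w. \<bar>wedge (mprod (A t) w *v r s) (\<kappa> s')\<bar>"
  have word: "set w \<subseteq> Inv" "length w = n" if "w \<in> words Inv n" for w n using that by (auto simp: words_def)
  have r: "r s \<noteq> 0" "\<kappa> s' \<noteq> 0" if "s \<in> Sing" "s' \<in> Sing" for s s'
    using nz[OF that, of "[]"] by (auto simp: wedge_def)
  have "\<forall>s\<in>Sing. \<forall>s'\<in>Sing. \<exists>n0. \<forall>n\<ge>n0. \<forall>w\<in>words Inv n. exp (- K * real n) \<le> ?f s s' w"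
    using lower by blast
  then obtain n0 where n0: "\<And>s s' n w. s \<in> Sing \<Longrightarrow> s' \<in> Sing \<Longrightarrow> n \<ge> n0 s s' \<Longrightarrow> w \<in> words Inv n \<Longrightarrow>
    exp (- K * real n) \<le> ?f s s' w" by metis
  define b1 where "b1 = (\<Sum>s\<in>Sing. \<bar>ln (norm (r s))\<bar>)"
  define b2 where "b2 = (\<Sum>s\<in>Sing. \<bar>ln (norm (\<kappa> s))\<bar>)"
  define b3 where "b3 = (\<Sum>s\<in>Sing. \<Sum>s'\<in>Sing. \<Sum>n<n0 s s'. \<Sum>w\<in>words Inv n. \<bar>ln (?f s s' w)\<bar>)"
  have b1: "\<bar>ln (norm (r s))\<bar> \<le> b1" if "s \<in> Sing" for s
    unfolding b1_def using that alph(1) by (intro member_le_sum) auto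
  have b2: "\<bar>ln (norm (\<kappa> s))\<bar> \<le> b2" if "s \<in> Sing" for s
    unfolding b2_def using that alph(1) by (intro member_le_sum) auto
  have b3: "\<bar>ln (?f s s' w)\<bar> \<le> b3" if "s \<in> Sing" "s' \<in> Sing" "n < n0 s s'" "w \<in> words Inv n" for s s' n w
  proof -
    have "\<bar>ln (?f s s' w)\<bar> \<le> (\<Sum>w\<in>words Inv n. \<bar>ln (?f s s' w)\<bar>)"
      using that finite_words[OF finite_Inv] by (intro member_le_sum) auto
    also have "\<dots> \<le> (\<Sum>n<n0 s s'. \<Sum>w\<in>words Inv n. \<bar>ln (?f s s' w)\<bar>)"
      using that by (intro member_le_sum[of n]) (auto intro!: sum_nonneg)
    also have "\<dots> \<le> (\<Sum>s'\<in>Sing. \<Sum>n<n0 s s'. \<Sum>w\<in>words Inv n. \<bar>ln (?f s s' w)\<bar>)"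
      using that alph(1) by (intro member_le_sum[of s']) (auto intro!: sum_nonneg)
    also have "\<dots> \<le> b3"
      unfolding b3_def using that alph(1) by (intro member_le_sum[of s]) (auto intro!: sum_nonneg)
    finally show ?thesis .
  qed
  have nonneg: "0 \<le> b1" "0 \<le> b2" "0 \<le> b3"
    unfolding b1_def b2_def b3_def by (intro sum_nonneg abs_ge_zero)+
  define K' where "K' = \<bar>K\<bar> + D + b1 + b2 + b3"
  have le_K': "c * real n + e \<le> K' * (real n + 1)"
    if "c \<le> \<bar>K\<bar> + D" "e \<le> b1 + b2 + b3" for c e n
  proof -
    have "c * real n \<le> K' * real n" using that nonneg by (intro mult_right_mono) (auto simp: K'_def)
    moreover have "e \<le> K'" using that D_nonneg by (simp add: K'_def)
    ultimately show ?thesis by (simp add: algebra_simps)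
  qed
  have upper: "ln (norm (mprod (A t) w *v r s)) \<le> D * real n + b1"
    if "s \<in> Sing" "w \<in> words Inv n" "mprod (A t) w *v r s \<noteq> 0" for s w n
  proof -
    have "ln (norm (mprod (A t) w *v r s)) \<le> ln (exp (D * real n) * norm (r s))"
      using word_norm_le[OF t word(1)[OF that(2)], of "r s"] that(3) r[OF that(1,1)]
      by (simp add: word(2)[OF that(2)])
    also have "\<dots> = D * real n + ln (norm (r s))" using r[OF that(1,1)] by (simp add: ln_mult_pos)
    finally show ?thesis using b1[OF that(1)] by linarith
  qed
  have "renewal_cocycle P Sing Inv (A t) r \<kappa> K'"
  proof (intro renewal_cocycle.intro)
    fix s w n assume s: "s \<in> Sing" and w: "w \<in> words Inv n"
    have x: "mprod (A t) w *v r s \<noteq> 0" using nz[OF s s word(1)[OF w]] by (auto simp: wedge_def)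
    have "ln (norm (r s)) \<le> ln (exp (D * real n) * norm (mprod (A t) w *v r s))"
      using word_norm_ge[OF t word(1)[OF w], of "r s"] r[OF s s] x by (simp add: word(2)[OF w])
    also have "\<dots> = D * real n + ln (norm (mprod (A t) w *v r s))" using x by (simp add: ln_mult_pos)
    finally have "\<bar>ln (norm (mprod (A t) w *v r s))\<bar> \<le> D * real n + b1"
      using upper[OF s w x] b1[OF s] by linarith
    also have "\<dots> \<le> K' * (real n + 1)" using nonneg by (intro le_K') auto
    finally show "\<bar>ln (norm (mprod (A t) w *v r s))\<bar> \<le> K' * (real n + 1)" .
    fix s' assume s': "s' \<in> Sing"
    show nz': "wedge (mprod (A t) w *v r s) (\<kappa> s') \<noteq> 0" using nz[OF s s' word(1)[OF w]] .
    have "ln (?f s s' w) \<le> ln (norm (mprod (A t) w *v r s) * norm (\<kappa> s'))"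
      using nz' x r[OF s s'] abs_wedge_le[of _ "\<kappa> s'"] by simp
    also have "\<dots> = ln (norm (mprod (A t) w *v r s)) + ln (norm (\<kappa> s'))"
      using x r[OF s s'] by (simp add: ln_mult_pos)
    finally have "ln (?f s s' w) \<le> D * real n + (b1 + b2)" using upper[OF s w x] b2[OF s'] by linarith
    also have "\<dots> \<le> K' * (real n + 1)" using nonneg by (intro le_K') auto
    finally have up: "ln (?f s s' w) \<le> K' * (real n + 1)" .
    have "- ln (?f s s' w) \<le> K' * (real n + 1)"
    proof (cases "n < n0 s s'")
      case True
      then have "- ln (?f s s' w) \<le> 0 * real n + b3" using b3[OF s s' True w] by linarith
      also have "\<dots> \<le> K' * (real n + 1)" using nonneg D_nonneg by (intro le_K') auto
      finally show ?thesis .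
    next
      case False
      then have "ln (exp (- K * real n)) \<le> ln (?f s s' w)"
        using n0[OF s s' _ w] nz' by (subst ln_le_cancel_iff) auto
      then have "- ln (?f s s' w) \<le> K * real n + 0" by simp
      also have "\<dots> \<le> K' * (real n + 1)" using nonneg D_nonneg by (intro le_K') auto
      finally show ?thesis .
    qed
    with up show "\<bar>ln (?f s s' w)\<bar> \<le> K' * (real n + 1)" by linarith
  qed (use alph sing finite_Inv in auto)
  then show ?thesis ..
qed

section \<open>Angles of lines, tails at rate 1 and null sets of \<open>eta_tilde\<close>\<close>

definition dir :: "real \<Rightarrow> real^2" where
  "dir \<theta> = vector [cos \<theta>, sin \<theta>]"

lemma dir_nz: "dir \<theta> \<noteq> 0"
proof
  assume "dir \<theta> = 0"
  then have "cos \<theta> = 0" "sin \<theta> = 0" by (auto simp: dir_def vec_eq_iff forall_2)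
  then show False using sin_cos_squared_add[of \<theta>] by simp
qed

text \<open>The corrections by \<open>pi\<close> in \<open>pang\<close> at most reverse the sign of
  \<open>dir\<close>. This lets the equation \<open>pang v = \<theta>\<close> be replaced by a
  condition continuous in \<open>\<theta>\<close>.\<close>

lemma wedge_dir_pang: "wedge v (dir (pang v)) = 0"
proof -
  define z where "z = Complex (v $ 1) (v $ 2)"
  have "z = rcis (cmod z) (Arg z)" by (simp add: rcis_cmod_Arg)
  then have "v $ 1 = cmod z * cos (Arg z)" "v $ 2 = cmod z * sin (Arg z)"
    by (metis Re_rcis complex.sel(1) z_def, metis Im_rcis complex.sel(2) z_def)
  then show ?thesis
    unfolding pang_def Let_def z_def[symmetric] by (auto simp: wedge_def dir_def)
qed

lemma eventually_exp_less:
  assumes "c > (0::real)"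
  shows "eventually (\<lambda>n. C * exp (- c * real n) < exp (- 1 * real n powr (1/3))) sequentially"
proof -
  \<comment> \<open>A positive constant in place of \<open>C\<close>, whose sign is unknown, makes
    the asymptotics definite.\<close>
  have "eventually (\<lambda>n. (\<bar>C\<bar> + 1) * exp (- c * real n) < exp (- 1 * real n powr (1/3))) sequentially"
    using assms by real_asymp
  then show ?thesis
  proof eventually_elim
    case (elim n)
    have "C * exp (- c * real n) \<le> (\<bar>C\<bar> + 1) * exp (- c * real n)" by (intro mult_right_mono) auto
    with elim show ?case by linarith
  qed
qed

text \<open>The two unit vectors on a line give the same norms, so one \<open>n0\<close> serves
  both. The pair \<open>v1\<close>, \<open>v2\<close> identifies \<open>L1\<close> with
  \<open>lyap\<close>.\<close>

lemma (in renewal_cocycle) vector_deviation_tail: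
  assumes "start v1" "start v2" "wedge v1 v2 \<noteq> 0" and "start x" and "\<epsilon> > 0"
  shows "\<exists>n0. \<forall>n\<ge>n0. \<forall>v. norm v = 1 \<and> (\<exists>c. v = c *\<^sub>R x) \<longrightarrow>
    measure (bernoulli P) {\<omega> \<in> space (bernoulli P). deviates n (norm (cocycle M n \<omega> *v v)) (L1 P M) \<epsilon>}
      < exp (- 1 * real n powr (1/3))"
proof -
  define v0 where "v0 = (1 / norm x) *\<^sub>R x"
  have nx: "norm x > 0" using start_nz[OF assms(4)] by simp
  have "start v0"
  proof -
    obtain c s m w where "c \<noteq> 0" "s \<in> Sing" "w \<in> words Inv m" "x = c *\<^sub>R (mprod M w *v r s)"
      using assms(4) by (auto simp: start_def)
    then have "(1 / norm x) * c \<noteq> 0" "v0 = ((1 / norm x) * c) *\<^sub>R (mprod M w *v r s)" using nx by (auto simp: v0_def)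
    then show ?thesis unfolding start_def using \<open>s \<in> Sing\<close> \<open>w \<in> words Inv m\<close> by blast
  qed
  then obtain C c where c: "c > 0" "\<And>n. n \<ge> 1 \<Longrightarrow> measure (bernoulli P)
    {\<omega>. deviates n (norm (cocycle M n \<omega> *v v0)) (ereal lyap) \<epsilon>} \<le> C * exp (- c * real n)"
    using vector_large_deviations[OF _ assms(5)] by blast
  obtain n0 where n0: "\<And>n. n \<ge> n0 \<Longrightarrow> C * exp (- c * real n) < exp (- 1 * real n powr (1/3))"
    using eventually_exp_less[OF c(1), of C] by (auto simp: eventually_sequentially)
  have "measure (bernoulli P) {\<omega> \<in> space (bernoulli P). deviates n (norm (cocycle M n \<omega> *v v)) (L1 P M) \<epsilon>}
      < exp (- 1 * real n powr (1/3))" if n: "n \<ge> max 1 n0" and v: "norm v = 1" "\<exists>c. v = c *\<^sub>R x" for n v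
  proof -
    obtain b where b: "v = b *\<^sub>R x" using v(2) by blast
    then have "v = (b * norm x) *\<^sub>R v0" using nx by (simp add: v0_def)
    moreover have "\<bar>b * norm x\<bar> = 1" using v(1) b by (simp add: abs_mult)
    ultimately have "norm (B *v v) = norm (B *v v0)" for B :: mat2
      by (simp add: matrix_vector_mult_scaleR)
    then show ?thesis
      using c(2)[of n] n0[of n] n by (simp add: L1_eq_lyap[OF assms(1-3)])
  qed
  then show ?thesis by blast
qed

lemma (in renewal_cocycle) norm_deviation_tail:
  assumes v: "start v1" "start v2" "wedge v1 v2 \<noteq> 0" and "\<epsilon> > 0"
  shows "\<exists>n0. \<forall>n\<ge>n0. measure (bernoulli P)
    {\<omega> \<in> space (bernoulli P). deviates n (mnorm (cocycle M n \<omega>)) (L1 P M) \<epsilon>} < exp (- 1 * real n powr (1/3))"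
proof -
  obtain C c N where c: "c > 0" "\<forall>n\<ge>N. measure (bernoulli P)
    {\<omega>. deviates n (mnorm (cocycle M n \<omega>)) (ereal lyap) \<epsilon>} \<le> C * exp (- c * real n)"
    using norm_large_deviations[OF v assms(4)] by blast
  obtain n0 where n0: "\<And>n. n \<ge> n0 \<Longrightarrow> C * exp (- c * real n) < exp (- 1 * real n powr (1/3))"
    using eventually_exp_less[OF c(1), of C] by (auto simp: eventually_sequentially)
  show ?thesis
    using c(2) n0 by (intro exI[of _ "max N n0"]) (force simp: L1_eq_lyap[OF v])
qed

text \<open>\<open>measure_of\<close> yields the zero measure when its argument is not a measure, so for null sets
  there is no need to show that \<open>eta\<close> and \<open>eta_tilde\<close> are given by measures.\<close>

lemma emeasure_eta_eq_0:
  assumes "\<And>s n w. s \<in> Sing \<Longrightarrow> w \<in> words Inv n \<Longrightarrow> pang (mprod M w *v rvec (M s)) \<notin> B"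
  shows "emeasure (eta P Sing Inv M) B = 0"
proof -
  have "(\<Sum>s\<in>Sing. ennreal (pmf P s) * (\<Sum>n. \<Sum>ws\<in>words Inv n. ennreal (wprob P ws) *
      indicator B (pang (mprod M ws *v rvec (M s))))) = 0"
    using assms by (intro sum.neutral ballI) (simp add: indicator_def cong: sum.cong)
  then show ?thesis unfolding eta_def by (simp add: emeasure_measure_of_conv)
qed

text \<open>\<open>Q\<close> itself need not be measurable, so the exceptional set is enclosed in
  the Borel set \<open>- G\<close>. For almost every \<open>t\<close> in \<open>\<Lambda>\<close>
  all atoms of \<open>eta\<close> lie in the section of \<open>G\<close>, so the integrand vanishes
  almost everywhere.\<close>

lemma AE_eta_tildeI:
  assumes G: "G \<in> sets borel" "\<And>t \<theta>. (t, \<theta>) \<in> G \<Longrightarrow> Q t \<theta>"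
    and AE: "AE t in lborel. t \<in> \<Lambda> \<longrightarrow> (\<forall>s\<in>Sing. \<forall>n. \<forall>w\<in>words Inv n.
      (t, pang (mprod (A t) w *v rvec (A t s))) \<in> G)"
  shows "AE (t, \<theta>) in eta_tilde P Sing Inv \<Lambda> A. Q t \<theta>"
proof (rule AE_I)
  have sets: "sets (eta_tilde P Sing Inv \<Lambda> A) = sets borel"
    unfolding eta_tilde_def using sets.sigma_sets_eq[of "borel :: (real \<times> real) measure"]
    by (simp add: sets_measure_of_conv)
  show "- G \<in> sets (eta_tilde P Sing Inv \<Lambda> A)" unfolding sets using G(1) by (simp add: borel_comp)
  show "{x \<in> space (eta_tilde P Sing Inv \<Lambda> A). \<not> (case x of (t, \<theta>) \<Rightarrow> Q t \<theta>)} \<subseteq> - G"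
    using G(2) by auto
  have "(\<integral>\<^sup>+ t. indicator \<Lambda> t * emeasure (eta P Sing Inv (A t)) (Pair t -` (- G)) \<partial>lborel)
      = (\<integral>\<^sup>+ t. 0 \<partial>(lborel :: real measure))"
  proof (rule nn_integral_cong_AE)
    show "AE t in lborel. indicator \<Lambda> t * emeasure (eta P Sing Inv (A t)) (Pair t -` (- G)) = (0 :: ennreal)"
      using AE
    proof eventually_elim
      case (elim t)
      then have "emeasure (eta P Sing Inv (A t)) (Pair t -` (- G)) = 0" if "t \<in> \<Lambda>"
        using that by (intro emeasure_eta_eq_0) auto
      then show ?case by (auto simp: indicator_def)
    qed
  qed
  then show "emeasure (eta_tilde P Sing Inv \<Lambda> A) (- G) = 0"
    unfolding eta_tilde_def by (simp add: emeasure_measure_of_conv)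
qed

text \<open>Each word contributes a closed set, by continuity in both variables, and there are
  countably many words and letters.\<close>

lemma (in winding_family) graph_measurable:
  fixes Sing :: "nat set"
  assumes T: "T \<in> sets borel" "T \<subseteq> {a..a+1}"
  shows "{(t, \<theta>). t \<in> T \<and> (\<exists>s\<in>Sing. \<exists>w\<in>lists Inv. wedge (mprod (A t) w *v r s) (dir \<theta>) = 0)} \<in> sets borel"
    (is "?G \<in> _")
proof -
  define Z where "Z = (\<lambda>s w. {p \<in> {a..a+1} \<times> UNIV. wedge (mprod (A (fst p)) w *v r s) (dir (snd p)) = 0})"
  have "closed (Z s w)" if w: "set w \<subseteq> Inv" for s w
  proof -
    obtain x' where x': "\<And>t. t \<in> {a..a+1} \<Longrightarrow> ((\<lambda>t. mprod (A t) w *v r s) has_vector_derivative x' t) (at t)"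
      using word_deriv[OF w] by blast
    have "continuous_on {a..a+1} (\<lambda>t. mprod (A t) w *v r s)"
      by (intro continuous_at_imp_continuous_on ballI has_vector_derivative_continuous[OF x'])
    then have "continuous_on ({a..a+1} \<times> (UNIV :: real set)) (\<lambda>p. mprod (A (fst p)) w *v r s)"
      by (rule continuous_on_compose2) (auto intro: continuous_intros)
    then have "continuous_on ({a..a+1} \<times> UNIV) (\<lambda>p. wedge (mprod (A (fst p)) w *v r s) (dir (snd p)))"
      unfolding wedge_def dir_def by (auto intro!: continuous_intros)
    then show ?thesis unfolding Z_def
      by (intro continuous_closed_preimage_constant closed_Times) auto
  qed
  then have "(\<Union>w\<in>lists Inv. Z s w) \<in> sets borel" for s
    by (intro sets.countable_UN') (auto intro: countableI_type borel_closed)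
  then have "(\<Union>s\<in>Sing. \<Union>w\<in>lists Inv. Z s w) \<in> sets borel"
    by (intro sets.countable_UN') (auto intro: countableI_type)
  moreover have "T \<times> (UNIV :: real set) \<in> sets borel"
    using T by (intro borel_Times) auto
  moreover have "?G = (T \<times> UNIV) \<inter> (\<Union>s\<in>Sing. \<Union>w\<in>lists Inv. Z s w)"
    using T(2) by (simp add: Z_def set_eq_iff subset_iff) blast
  ultimately show ?thesis by simp
qed

text \<open>The parameters satisfying \<open>Q\<close> need not form a Borel set; the interval minus
  a Borel null set does.\<close>

lemma AE_obtain_borel_subset:
  fixes a b :: real
  assumes "AE t in lborel. t \<in> {a..b} \<longrightarrow> Q t"
  obtains T where "T \<in> sets borel" "T \<subseteq> {a..b}" "\<And>t. t \<in> T \<Longrightarrow> Q t"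
    "AE t in lborel. t \<in> {a..b} \<longrightarrow> t \<in> T"
proof -
  obtain N where N: "{t. \<not> (t \<in> {a..b} \<longrightarrow> Q t)} \<subseteq> N" "N \<in> null_sets lborel"
    using assms by (auto simp: eventually_ae_filter)
  show thesis
  proof (rule that)
    show "{a..b} - N \<in> sets borel" using N(2) by auto
    show "AE t in lborel. t \<in> {a..b} \<longrightarrow> t \<in> {a..b} - N" using AE_not_in[OF N(2)] by eventually_elim auto
  qed (use N(1) in auto)
qed

theorem theorem3p1:
  fixes k :: nat and Sing Inv :: "nat set" and P :: "nat pmf"
    and a :: real and A :: "real \<Rightarrow> nat \<Rightarrow> real^2^2"
  assumes alph: "Sing \<union> Inv = {1..k}" "Sing \<inter> Inv = {}" "Sing \<noteq> {}" "Inv \<noteq> {}"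
    and supp: "set_pmf P = {1..k}"
    and Mstar: "\<forall>t\<in>{a..a+1}. in_Mstar Sing Inv (A t)"
    and smooth: "\<forall>i\<in>{1..k}. smooth_mat_family {a..a+1} (\<lambda>t. A t i)"
    and A1: "\<forall>i\<in>Sing. \<forall>t\<in>{a..a+1}. \<forall>s\<in>{a..a+1}. A t i = A s i"
    and A2: "\<exists>c0>0. \<forall>t\<in>{a..a+1}. \<forall>j\<in>Inv. \<forall>v::real^2. v \<noteq> 0 \<longrightarrow>
              wedge (A t j *v v) (vector_derivative (\<lambda>s. A s j *v v) (at t))
                / (norm (A t j *v v))\<^sup>2 \<ge> c0"
  shows "(\<forall>\<epsilon>>0. \<exists>c>0. AE (t, \<theta>) in eta_tilde P Sing Inv {a..a+1} A.
            \<exists>n0. \<forall>n\<ge>n0. \<forall>v::real^2. norm v = 1 \<and> pang v = \<theta> \<longrightarrow>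
              measure (bernoulli P) {\<omega> \<in> space (bernoulli P).
                 deviates n (norm (cocycle (A t) n \<omega> *v v)) (L1 P (A t)) \<epsilon>}
               < exp (- c * real n powr (1/3)))
       \<and> (\<exists>c::real \<Rightarrow> real. (\<forall>\<epsilon>>0. c \<epsilon> > 0) \<and>
            (AE t in lborel. t \<in> {a..a+1} \<longrightarrow>
              (\<forall>\<epsilon>>0. \<exists>n0. \<forall>n\<ge>n0.
                 measure (bernoulli P) {\<omega> \<in> space (bernoulli P).
                   deviates n (mnorm (cocycle (A t) n \<omega>)) (L1 P (A t)) \<epsilon>}
                 < exp (- c \<epsilon> * real n powr (1/3)))))"
proof -
  have fin: "finite Sing" "finite Inv"
    using alph(1) by (metis finite_Un finite_atLeastAtMost)+
  have in_alph: "i \<in> {1..k}" if "i \<in> Sing \<or> i \<in> Inv" for i using alph(1) that by blast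
  obtain c0 where c0: "c0 > 0" "\<And>t j v. t \<in> {a..a+1} \<Longrightarrow> j \<in> Inv \<Longrightarrow> v \<noteq> 0 \<Longrightarrow>
      wedge (A t j *v v) (vector_derivative (\<lambda>s. A s j *v v) (at t)) / (norm (A t j *v v))\<^sup>2 \<ge> c0"
    using A2 by blast
  have Mstar': "\<And>t s. t \<in> {a..a+1} \<Longrightarrow> s \<in> Sing \<Longrightarrow> rank (A t s) = 1"
    "\<And>t j. t \<in> {a..a+1} \<Longrightarrow> j \<in> Inv \<Longrightarrow> det (A t j) > 0"
    "\<And>t s s'. t \<in> {a..a+1} \<Longrightarrow> s \<in> Sing \<Longrightarrow> s' \<in> Sing \<Longrightarrow> range_space (A t s) \<noteq> kernel_space (A t s')"
    using Mstar unfolding in_Mstar_def by blast+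
  have "\<exists>A' D. winding_family A A' Inv a c0 D"
    using smooth in_alph Mstar'(2) c0 fin(2) by (intro winding_familyI) auto
  then obtain A' D where "winding_family A A' Inv a c0 D" by blast
  then interpret winding_family A A' Inv a c0 D .
  have a_in: "a \<in> {a..a+1}" by simp
  \<comment> \<open>By (A1) the singular matrices do not depend on \<open>t\<close>, so vectors
    taken at \<open>t = a\<close> serve the whole interval.\<close>
  define r where "r = (\<lambda>s. rvec (A a s))"
  have const: "A t s = A a s" if "s \<in> Sing" "t \<in> {a..a+1}" for s t using A1 that a_in by blast
  have "\<forall>s\<in>Sing. \<exists>\<kappa>. \<kappa> \<noteq> 0 \<and> r s \<noteq> 0 \<and> (\<forall>x. A a s *v x = wedge x \<kappa> *\<^sub>R r s) \<and>
      range_space (A a s) = range (\<lambda>c. c *\<^sub>R r s) \<and> kernel_space (A a s) = {x. wedge x \<kappa> = 0}"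
    using rank_one_decomposition[OF Mstar'(1)[OF a_in]] unfolding r_def by blast
  from bchoice[OF this] obtain \<kappa> where "\<forall>s\<in>Sing. \<kappa> s \<noteq> 0 \<and> r s \<noteq> 0 \<and>
      (\<forall>x. A a s *v x = wedge x (\<kappa> s) *\<^sub>R r s) \<and>
      range_space (A a s) = range (\<lambda>c. c *\<^sub>R r s) \<and> kernel_space (A a s) = {x. wedge x (\<kappa> s) = 0}" ..
  then have \<kappa>: "\<And>s. s \<in> Sing \<Longrightarrow> \<kappa> s \<noteq> 0" "\<And>s. s \<in> Sing \<Longrightarrow> r s \<noteq> 0"
    "\<And>s x. s \<in> Sing \<Longrightarrow> A a s *v x = wedge x (\<kappa> s) *\<^sub>R r s"
    "\<And>s. s \<in> Sing \<Longrightarrow> range_space (A a s) = range (\<lambda>c. c *\<^sub>R r s)"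
    "\<And>s. s \<in> Sing \<Longrightarrow> kernel_space (A a s) = {x. wedge x (\<kappa> s) = 0}"
    by blast+
  \<comment> \<open>The case of the empty word, where nothing winds: if \<open>r s\<close> were
    parallel to \<open>\<kappa> s'\<close>, the range of \<open>A a s\<close> would be the kernel of
    \<open>A a s'\<close>, against \<open>in_Mstar\<close>.\<close>
  have nz0: "wedge (r s) (\<kappa> s') \<noteq> 0" if s: "s \<in> Sing" "s' \<in> Sing" for s s'
  proof
    assume "wedge (r s) (\<kappa> s') = 0"
    then obtain c where c: "r s = c *\<^sub>R \<kappa> s'" using wedge_eq_0_iff[OF \<kappa>(1)[OF s(2)]] by blast
    then have "c \<noteq> 0" using \<kappa>(2)[OF s(1)] by auto
    then have "b *\<^sub>R \<kappa> s' \<in> range (\<lambda>b. b *\<^sub>R r s)" for b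
      by (intro image_eqI[of _ _ "b / c"]) (simp_all add: c)
    moreover have "b *\<^sub>R r s \<in> range (\<lambda>b. b *\<^sub>R \<kappa> s')" for b
      by (intro image_eqI[of _ _ "b * c"]) (simp_all add: c)
    ultimately have "range (\<lambda>b. b *\<^sub>R r s) = range (\<lambda>b. b *\<^sub>R \<kappa> s')" by blast
    then show False
      using Mstar'(3)[OF a_in s] wedge_eq_0_iff[OF \<kappa>(1)[OF s(2)]] by (auto simp: \<kappa>(4,5) s)
  qed
  obtain s0 j0 where s0: "s0 \<in> Sing" and j0: "j0 \<in> Inv" using alph(3,4) by blast
  define K where "K = 3 * D + 2 + ln (real (card Inv) + 1)"
  \<comment> \<open>The last clause provides a second direction, not parallel to
    \<open>r s0\<close>, for the matrix norm and for \<open>L1\<close>.\<close>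
  define good where "good = (\<lambda>t. (\<forall>s\<in>Sing. \<forall>s'\<in>Sing.
      (\<forall>w\<in>lists Inv. w \<noteq> [] \<longrightarrow> wedge (mprod (A t) w *v r s) (\<kappa> s') \<noteq> 0) \<and>
      (\<exists>n0. \<forall>n\<ge>n0. \<forall>w\<in>words Inv n. exp (- K * real n) \<le> \<bar>wedge (mprod (A t) w *v r s) (\<kappa> s')\<bar>))
    \<and> wedge (mprod (A t) [j0] *v r s0) (r s0) \<noteq> 0)"
  have AE_good: "AE t in lborel. t \<in> {a..a+1} \<longrightarrow> good t"
  proof -
    have "AE t in lborel. t \<in> {a..a+1} \<longrightarrow> wedge (mprod (A t) w *v r s) (\<kappa> s') \<noteq> 0"
      if "s \<in> Sing" "s' \<in> Sing" "w \<in> lists Inv" "w \<noteq> []" for s s' w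
      using that \<kappa> by (intro AE_nonresonant[of w "length w"]) (auto simp: words_def Suc_le_eq)
    \<comment> \<open>Letters and words are countable, so the exceptional parameters still form a
      null set.\<close>
    then have "AE t in lborel. \<forall>s\<in>Sing. \<forall>s'\<in>Sing. \<forall>w\<in>lists Inv - {[]}.
        t \<in> {a..a+1} \<longrightarrow> wedge (mprod (A t) w *v r s) (\<kappa> s') \<noteq> 0"
      unfolding AE_ball_countable[OF countableI_type] by blast
    moreover have "AE t in lborel. \<forall>s\<in>Sing. \<forall>s'\<in>Sing. t \<in> {a..a+1} \<longrightarrow>
        (\<exists>n0. \<forall>n\<ge>n0. \<forall>w\<in>words Inv n. exp (- K * real n) \<le> \<bar>wedge (mprod (A t) w *v r s) (\<kappa> s')\<bar>)"
      unfolding AE_ball_countable[OF countableI_type] K_def using \<kappa>(1,2) AE_wedge_lower_bound by blast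
    moreover have "AE t in lborel. t \<in> {a..a+1} \<longrightarrow> wedge (mprod (A t) [j0] *v r s0) (r s0) \<noteq> 0"
      using j0 \<kappa>(2)[OF s0] by (intro AE_nonresonant[of _ 1]) (auto simp: words_def)
    ultimately show ?thesis by eventually_elim (auto simp: good_def)
  qed
  have good_cocycle: "\<exists>K'. renewal_cocycle P Sing Inv (A t) r \<kappa> K'" if t: "t \<in> {a..a+1}" "good t" for t
  proof (rule renewal_cocycleI[OF t(1) fin(1) alph(2-4), where K = K])
    fix s s' w assume s: "s \<in> Sing" "s' \<in> Sing" "set w \<subseteq> Inv"
    then have "w \<in> lists Inv" by auto
    then show "wedge (mprod (A t) w *v r s) (\<kappa> s') \<noteq> 0"
      using s(1,2) t(2) nz0 unfolding good_def by (cases "w = []") (simp, blast)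
  next
    show "set_pmf P = Sing \<union> Inv" using supp alph(1) by simp
    show "A t s *v x = wedge x (\<kappa> s) *\<^sub>R r s" if "s \<in> Sing" for s x
      using \<kappa>(3)[OF that] const[OF that t(1)] by simp
    show "\<exists>n0. \<forall>n\<ge>n0. \<forall>w\<in>words Inv n. exp (- K * real n) \<le> \<bar>wedge (mprod (A t) w *v r s) (\<kappa> s')\<bar>"
      if "s \<in> Sing" "s' \<in> Sing" for s s'
      using t(2) that unfolding good_def by blast
  qed
  have tails: "(\<forall>s\<in>Sing. \<forall>w\<in>lists Inv. \<exists>n0. \<forall>n\<ge>n0. \<forall>v. norm v = 1 \<and> (\<exists>c. v = c *\<^sub>R (mprod (A t) w *v r s)) \<longrightarrow>
        measure (bernoulli P) {\<omega> \<in> space (bernoulli P). deviates n (norm (cocycle (A t) n \<omega> *v v)) (L1 P (A t)) \<epsilon>}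
          < exp (- 1 * real n powr (1/3))) \<and>
      (\<exists>n0. \<forall>n\<ge>n0. measure (bernoulli P)
        {\<omega> \<in> space (bernoulli P). deviates n (mnorm (cocycle (A t) n \<omega>)) (L1 P (A t)) \<epsilon>}
          < exp (- 1 * real n powr (1/3)))"
    if t: "t \<in> {a..a+1}" "good t" and \<epsilon>: "\<epsilon> > 0" for t \<epsilon>
  proof -
    obtain K' where "renewal_cocycle P Sing Inv (A t) r \<kappa> K'" using good_cocycle[OF t] by blast
    then interpret R: renewal_cocycle P Sing Inv "A t" r \<kappa> K' .
    have start: "R.start (mprod (A t) w *v r s)" if "s \<in> Sing" "w \<in> lists Inv" for s w
      unfolding R.start_def using that
      by (intro exI[of _ 1] exI[of _ s] exI[of _ "length w"] exI[of _ w]) (auto simp: words_def)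
    have v: "R.start (mprod (A t) [j0] *v r s0)" "R.start (r s0)"
      using start[OF s0, of "[j0]"] start[OF s0, of "[]"] j0 by auto
    have w: "wedge (mprod (A t) [j0] *v r s0) (r s0) \<noteq> 0" using t(2) by (simp add: good_def)
    show ?thesis
      using R.vector_deviation_tail[OF v w start \<epsilon>] R.norm_deviation_tail[OF v w \<epsilon>] by blast
  qed
  obtain T where T: "T \<in> sets borel" "T \<subseteq> {a..a+1}" "\<And>t. t \<in> T \<Longrightarrow> good t"
    "AE t in lborel. t \<in> {a..a+1} \<longrightarrow> t \<in> T"
    using AE_obtain_borel_subset[OF AE_good] by blast
  \<comment> \<open>Contains all atoms over the parameters in \<open>T\<close>, described by
    \<open>wedge\<close> and \<open>dir\<close> instead of \<open>pang\<close> so that it is visibly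
    Borel.\<close>
  define G where "G = {(t, \<theta>). t \<in> T \<and> (\<exists>s\<in>Sing. \<exists>w\<in>lists Inv. wedge (mprod (A t) w *v r s) (dir \<theta>) = 0)}"
  have "AE (t, \<theta>) in eta_tilde P Sing Inv {a..a+1} A. \<exists>n0. \<forall>n\<ge>n0. \<forall>v::real^2. norm v = 1 \<and> pang v = \<theta> \<longrightarrow>
      measure (bernoulli P) {\<omega> \<in> space (bernoulli P). deviates n (norm (cocycle (A t) n \<omega> *v v)) (L1 P (A t)) \<epsilon>}
        < exp (- 1 * real n powr (1/3))" if \<epsilon>: "\<epsilon> > 0" for \<epsilon>
  proof (rule AE_eta_tildeI[where G = G])
    show "G \<in> sets borel" unfolding G_def by (rule graph_measurable[OF T(1,2)])
    show "AE t in lborel. t \<in> {a..a+1} \<longrightarrow> (\<forall>s\<in>Sing. \<forall>n. \<forall>w\<in>words Inv n.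
        (t, pang (mprod (A t) w *v rvec (A t s))) \<in> G)"
      using T(4)
    proof eventually_elim
      case (elim t)
      show ?case
      proof (intro impI ballI allI)
        fix s n w assume t: "t \<in> {a..a+1}" and s: "s \<in> Sing" and w: "w \<in> words Inv n"
        have "rvec (A t s) = r s" by (simp only: r_def const[OF s t])
        moreover have "w \<in> lists Inv" using w by (auto simp: words_def)
        ultimately show "(t, pang (mprod (A t) w *v rvec (A t s))) \<in> G"
          using elim t s wedge_dir_pang[of "mprod (A t) w *v r s"] unfolding G_def by auto
      qed
    qed
    fix t \<theta> assume "(t, \<theta>) \<in> G"
    then obtain s w where t: "t \<in> {a..a+1}" "good t" and s: "s \<in> Sing" "w \<in> lists Inv"
      and x: "wedge (mprod (A t) w *v r s) (dir \<theta>) = 0"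
      using T(2,3) unfolding G_def by blast
    have "mprod (A t) w *v r s \<noteq> 0"
      using word_norm_ge[OF t(1), of w "r s"] s \<kappa>(2) by (auto simp: in_lists_conv_set subset_iff)
    moreover obtain c where c: "mprod (A t) w *v r s = c *\<^sub>R dir \<theta>"
      using x unfolding wedge_eq_0_iff[OF dir_nz] ..
    ultimately have c0: "c \<noteq> 0" by auto
    \<comment> \<open>The angle determines the line, so the tail bound for the line of
      \<open>mprod (A t) w *v r s\<close> applies to every unit \<open>v\<close> with
      \<open>pang v = \<theta>\<close>.\<close>
    have par: "\<exists>b. v = b *\<^sub>R (mprod (A t) w *v r s)" if v: "pang v = \<theta>" for v
    proof -
      obtain d where "v = d *\<^sub>R dir \<theta>"
        using wedge_dir_pang[of v] unfolding v wedge_eq_0_iff[OF dir_nz] ..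
      then have "v = (d / c) *\<^sub>R (mprod (A t) w *v r s)" using c0 by (simp add: c)
      then show ?thesis ..
    qed
    obtain n0 where "\<forall>n\<ge>n0. \<forall>v. norm v = 1 \<and> (\<exists>c. v = c *\<^sub>R (mprod (A t) w *v r s)) \<longrightarrow>
        measure (bernoulli P) {\<omega> \<in> space (bernoulli P). deviates n (norm (cocycle (A t) n \<omega> *v v)) (L1 P (A t)) \<epsilon>}
          < exp (- 1 * real n powr (1/3))"
      using bspec[OF bspec[OF conjunct1[OF tails[OF t \<epsilon>]] s(1)] s(2)] ..
    then show "\<exists>n0. \<forall>n\<ge>n0. \<forall>v::real^2. norm v = 1 \<and> pang v = \<theta> \<longrightarrow>
      measure (bernoulli P) {\<omega> \<in> space (bernoulli P). deviates n (norm (cocycle (A t) n \<omega> *v v)) (L1 P (A t)) \<epsilon>}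
        < exp (- 1 * real n powr (1/3))"
      using par by blast
  qed
  moreover have "AE t in lborel. t \<in> {a..a+1} \<longrightarrow> (\<forall>\<epsilon>>0. \<exists>n0. \<forall>n\<ge>n0.
      measure (bernoulli P) {\<omega> \<in> space (bernoulli P). deviates n (mnorm (cocycle (A t) n \<omega>)) (L1 P (A t)) \<epsilon>}
        < exp (- 1 * real n powr (1/3)))"
    using AE_good by eventually_elim (use tails in blast)
  ultimately show ?thesis
    by (intro conjI allI impI exI[of _ "1 :: real"] exI[of _ "\<lambda>_. 1 :: real"]) simp_all
qed

end
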